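(* The recurrence coefficients $(a_n)_{n=1}^\infty$ can be calculated recursively by using the following two facts: (i) for all $s\in\mathbb{N}_0$ and $k\in\mathbb{N}$, $$a_{2^s(2k+1)}^2\, a_{2^s(2k+1)-1}^2\cdots a_{2^{s+1}k+1}^2+a_{2^{s+1}k}^2\,a_{2^{s+1}k-1}^2\cdots a_{2^{s+1}k-2^s+1}^2= \|Q_{2^s}\|^2;$$ (ii) for all $s\in\mathbb{N}_0$, $$\|Q_{2^s}\|^2=\int Q_{2^s}^2\,d\mu_{K(\gamma)}=(1-2\,\gamma_{s+1})\,r_s^2/4.$$
   Context: $\mathbb{N}_0=\mathbb{N}\cup\{0\}$. Let $\gamma=(\gamma_s)_{s=1}^\infty$ with $0<\gamma_s<1/4$ for all $s$. Put $r_0=1$ and $r_s=\gamma_s r_{s-1}^2$ for $s\ge 1$. Define polynomials recursively by $P_1(x)=x-1$ and $P_{2^{s+1}}(x)=P_{2^s}(x)\,(P_{2^s}(x)+r_s)$ for $s\in\mathbb{N}_0$. Let $E_s=\{x\in\mathbb{R}: P_{2^{s+1}}(x)\le 0\}$; then $E_{s+1}\subset E_s$ and $K(\gamma)=\bigcap_{s=0}^\infty E_s$ is a Cantor set. It is assumed that $K(\gamma)$ has positive logarithmic capacity, where $Cap(K(\gamma))=\exp\left(\sum_{k=1}^\infty 2^{-k}\log\gamma_k\right)$. $\mu_{K(\gamma)}$ is the equilibrium measure of $K(\gamma)$, $\|\cdot\|$ is the norm of $L^2(\mu_{K(\gamma)})$, and $Q_n$ is the monic orthogonal polynomial of degree $n$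 with respect to $\mu_{K(\gamma)}$. The recurrence coefficients (Jacobi parameters) $a_n>0$, $b_n\in\mathbb{R}$ are those in the three-term recurrence $Q_{n+1}(x)=(x-b_{n+1})Q_n(x)-a_n^2Q_{n-1}(x)$, $n\in\mathbb{N}_0$, with $Q_{-1}=0$, $Q_0=1$; they satisfy $\|Q_n\|=a_1\cdots a_n$. *)

theory Defs
  imports "HOL-Probability.Probability" "HOL-Computational_Algebra.Polynomial"
begin

section \<open>The sets K(\<gamma>)\<close>

text \<open>The parameter sequence is indexed from 1; the value \<open>\<gamma> 0\<close> is never used.\<close>

fun rr :: "(nat \<Rightarrow> real) \<Rightarrow> nat \<Rightarrow> real" where
  "rr \<gamma> 0 = 1"
| "rr \<gamma> (Suc s) = \<gamma> (Suc s) * (rr \<gamma> s)\<^sup>2"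

text \<open>\<open>PP \<gamma> s\<close> is the polynomial $P_{2^s}$, of degree $2^s$.\<close>

fun PP :: "(nat \<Rightarrow> real) \<Rightarrow> nat \<Rightarrow> real poly" where
  "PP \<gamma> 0 = [:-1, 1:]"
| "PP \<gamma> (Suc s) = PP \<gamma> s * (PP \<gamma> s + [:rr \<gamma> s:])"

definition E_level :: "(nat \<Rightarrow> real) \<Rightarrow> nat \<Rightarrow> real set" where
  "E_level \<gamma> s = {x. poly (PP \<gamma> (Suc s)) x \<le> 0}"

definition K_set :: "(nat \<Rightarrow> real) \<Rightarrow> real set" where
  "K_set \<gamma> = (\<Inter>s. E_level \<gamma> s)"

section \<open>Logarithmic potential theory for compact subsets of the real line\<close>

text \<open>All sets considered lie in the real line, so only Borel measures on the reals are needed: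
  Borel probability measures on the complex plane carried by a real set K are the same thing.\<close>

definition prob_measures_on :: "real set \<Rightarrow> real measure set" where
  "prob_measures_on K = {\<mu>. prob_space \<mu> \<and> sets \<mu> = sets borel \<and> emeasure \<mu> K = 1}"

text \<open>The kernel $\log (1/|x-y|)$. The diagonal needs a separate clause because
  \<open>ln 0 = 0\<close> in HOL.\<close>

definition log_kernel :: "real \<Rightarrow> real \<Rightarrow> ereal" where
  "log_kernel x y = (if x = y then \<infinity> else ereal (ln (1 / \<bar>x - y\<bar>)))"

text \<open>The energy is the integral of the positive part minus that of the negative part
  (\<open>e2ennreal\<close> sends negative numbers to 0). For measures on a bounded set the
  kernel is bounded below, so the subtracted term is finite.\<close>

definition log_energy :: "real measure \<Rightarrow> ereal" where
  "log_energy \<mu> =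
     enn2ereal (\<integral>\<^sup>+ x. \<integral>\<^sup>+ y. e2ennreal (log_kernel x y) \<partial>\<mu> \<partial>\<mu>)
   - enn2ereal (\<integral>\<^sup>+ x. \<integral>\<^sup>+ y. e2ennreal (- log_kernel x y) \<partial>\<mu> \<partial>\<mu>)"

definition min_energy :: "real set \<Rightarrow> ereal" where
  "min_energy K = (INF \<mu>\<in>prob_measures_on K. log_energy \<mu>)"

text \<open>For compact K, \<open>min_energy K\<close> is never \<open>-\<infinity>\<close>, so
  \<open>real_of_ereal\<close> is applied to a finite value only.\<close>

definition log_capacity :: "real set \<Rightarrow> real" where
  "log_capacity K = (if min_energy K = \<infinity> then 0 else exp (- real_of_ereal (min_energy K)))"

definition is_equilibrium_measure :: "real set \<Rightarrow> real measure \<Rightarrow> bool" where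
  "is_equilibrium_measure K \<mu> \<longleftrightarrow>
     \<mu> \<in> prob_measures_on K \<and> log_energy \<mu> = min_energy K"

section \<open>Orthogonal polynomials and recurrence coefficients\<close>

definition L2_norm :: "real measure \<Rightarrow> (real \<Rightarrow> real) \<Rightarrow> real" where
  "L2_norm \<mu> f = sqrt (LINT x|\<mu>. (f x)\<^sup>2)"

definition monic_orthogonal_polys :: "real measure \<Rightarrow> (nat \<Rightarrow> real poly) \<Rightarrow> bool" where
  "monic_orthogonal_polys \<mu> Q \<longleftrightarrow>
     (\<forall>n. degree (Q n) = n \<and> lead_coeff (Q n) = 1) \<and>
     (\<forall>m n. m \<noteq> n \<longrightarrow> (LINT x|\<mu>. poly (Q m) x * poly (Q n) x) = 0)"

text \<open>The convention $Q_{-1} = 0$ is built into the case \<open>n = 0\<close>; hence \<open>a 0\<close> and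
  \<open>b 0\<close> play no role.\<close>

definition recurrence_coeffs ::
    "(nat \<Rightarrow> real poly) \<Rightarrow> (nat \<Rightarrow> real) \<Rightarrow> (nat \<Rightarrow> real) \<Rightarrow> bool" where
  "recurrence_coeffs Q a b \<longleftrightarrow>
     (\<forall>n\<ge>1. a n > 0) \<and>
     (\<forall>n. Q (Suc n) = [:- b (Suc n), 1:] * Q n
            - smult ((a n)\<^sup>2) (if n = 0 then 0 else Q (n - 1)))"

text \<open>The equations from which \<open>c 1, \<dots>, c N\<close> are to be computed successively.
  The common right-hand side is the value of $\|Q_{2^s}\|^2$. The first family (with \<open>k \<ge> 1\<close>)
  has largest index $2^s(2k+1)$ and so covers every index that is not a power of 2; the second
  family, which encodes $\|Q_{2^s}\| = a_1 \cdots a_{2^s}$, covers the powers of 2.\<close>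

definition coeff_system :: "(nat \<Rightarrow> real) \<Rightarrow> nat \<Rightarrow> (nat \<Rightarrow> real) \<Rightarrow> bool" where
  "coeff_system \<gamma> N c \<longleftrightarrow>
     (\<forall>s k. k \<ge> 1 \<and> 2^s * (2*k+1) \<le> N \<longrightarrow>
        (\<Prod>j = 2^(s+1)*k + 1 .. 2^s*(2*k+1). (c j)\<^sup>2)
      + (\<Prod>j = 2^(s+1)*k - 2^s + 1 .. 2^(s+1)*k. (c j)\<^sup>2)
      = (1 - 2 * \<gamma> (s+1)) * (rr \<gamma> s)\<^sup>2 / 4) \<and>
     (\<forall>s. 2^s \<le> N \<longrightarrow>
        (\<Prod>j = 1 .. 2^s. c j)\<^sup>2 = (1 - 2 * \<gamma> (s+1)) * (rr \<gamma> s)\<^sup>2 / 4)"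

end

theory Submission
  imports Defs
begin

text \<open>Put $T_s = P_{2^s} + r_s/2$ and $c_s = r_s^2/4 - r_{s+1}/2$. Completing the square in the
recursion gives $T_{s+1} = T_s^2 - c_s$, and $x \in K(\gamma)$ means $|T_s(x)| \le r_s/2$ for
all $s$. Everything rests on one property of the equilibrium measure \<open>\<mu>\<close>: for every $s$ the
distribution of $T_s$ under \<open>\<mu>\<close> is symmetric about 0 (\<open>equilibrium_symmetric\<close>).

The symmetry is proved by induction on $s$. The set $K(\gamma)$ has a Borel self-map
(\<open>level_flip\<close>) that sends $T_s$ to $-T_s$; pushing \<open>\<mu>\<close> forward along it gives a competitor
\<open>\<nu>\<close>. If the law of $T_i$ is symmetric for all $i < s$, then the energy of \<open>\<mu>\<close> can be rewritten
in terms of $T_s$ alone, because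
$\log\frac1{|a-b|} + \log\frac1{|a+b|} = \log\frac1{|a^2-b^2|}$
doubles the energy in each passage from $T_i$ to $T_{i+1} = T_i^2 - c_i$
(\<open>level_energy_eq\<close>). Rewritten like this the energy does not see the sign of $T_s$, so
\<open>\<nu>\<close> has the same energy as \<open>\<mu>\<close>. The energy minimiser is unique
(\<open>energy_minimizer_unique\<close>), hence $\mu = \nu$ and $T_s$ has a symmetric law. Uniqueness is
strict convexity of the energy, which for subsets of $[0,1]$ comes from the representation
$\log\frac1d = (1-d) + \int_0^1 (h-d)_+ \, h^{-2}\,dh$, where
$(h-|x-y|)_+$ is the length of the set of all $u$ for which the window $(u,u+h]$ contains both
$x$ and $y$: the energy is an integral of squares of window masses.

The rest is algebra. A symmetric law makes the orthogonal polynomials of $T_s$ even or odd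
according to their degree, and the even ones are the orthogonal polynomials of
$T_{s+1} = T_s^2 - c_s$. So $Q_{2^s m}$ is the $m$-th orthogonal polynomial of the law of $T_s$,
composed with $T_s$ (\<open>level_sequence\<close>); in particular $Q_{2^s} = T_s$. Since $Q_{2^{s+1}k}^2$ is
an even function of $T_{s+1}$, the integral of $T_{s+1} Q_{2^{s+1}k}^2$ vanishes, that is,
$\int T_s^2 Q_{2^{s+1}k}^2\,d\mu = c_s \|Q_{2^{s+1}k}\|^2$. Taking $k = 0$ gives
$\|Q_{2^s}\|^2 = c_s$, which is (ii). Expanding the left side by the three-term relation
$T_s Q_{2^{s+1}k} = Q_{2^s(2k+1)} + A\, Q_{2^s(2k-1)}$ gives (i), because the products of squared
recurrence coefficients are quotients of squared norms. Finally, every $n \ge 1$ is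
$2^s(2k+1)$ for unique $s$ and $k$, and the equation belonging to $(s,k)$ determines the positive
number $a_n$ from its predecessors.\<close>

section \<open>Orthogonal polynomials of a symmetric moment functional\<close>

text \<open>The functional \<open>L\<close> stands for integration of polynomials against a measure. Working with
functionals lets the same lemmas serve for all the laws of $T_0, T_1, T_2, \dots$ under one
measure.\<close>

locale orthogonal_sequence =
  fixes L :: "real poly \<Rightarrow> real" and q :: "nat \<Rightarrow> real poly"
  assumes L_add: "L (p + r) = L p + L r"
    and L_smult: "L (smult c p) = c * L p"
    and degree_q: "degree (q n) = n"
    and lead_coeff_q: "lead_coeff (q n) = 1"
    and orthogonal: "m \<noteq> n \<Longrightarrow> L (q m * q n) = 0"
    and norm_pos: "L (q n * q n) > 0"
begin

lemma L_diff: "L (p - r) = L p - L r"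
  using L_add[of p "smult (-1) r"] L_smult[of "-1" r] by simp

lemma L_zero [simp]: "L 0 = 0"
  using L_smult[of 0 0] by simp

lemma coeff_q_top: "coeff (q n) n = 1"
  using lead_coeff_q[of n] by (simp add: degree_q)

lemma reduce_degree:
  assumes "degree p \<le> n"
  shows "p - smult (coeff p n) (q n) = 0 \<or> degree (p - smult (coeff p n) (q n)) < n"
proof -
  let ?r = "p - smult (coeff p n) (q n)"
  have "degree ?r \<le> n"
    by (intro degree_diff_le assms) (metis degree_q degree_smult_le)
  moreover have "coeff ?r n = 0"
    by (simp add: coeff_q_top)
  ultimately show ?thesis
    by (metis leading_coeff_0_iff linorder_not_le le_antisym)
qed

text \<open>Subtracting a multiple of \<open>q m\<close> lowers the degree of a polynomial of degree \<open>m\<close>, so all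
polynomials of degree below \<open>n\<close> lie in the span of \<open>q 0, \<dots>, q (n - 1)\<close>.\<close>

lemma orthogonal_lower_degree:
  assumes "degree p < n"
  shows "L (q n * p) = 0"
proof -
  have "degree p < m \<Longrightarrow> m \<le> n \<Longrightarrow> L (q n * p) = 0" for m
  proof (induction m arbitrary: p)
    case (Suc m)
    let ?r = "p - smult (coeff p m) (q m)"
    have "L (q n * ?r) = 0"
      using reduce_degree[of p m] Suc by auto
    moreover have "L (q n * q m) = 0"
      using orthogonal Suc.prems by simp
    ultimately show ?case
      by (simp add: right_diff_distrib L_diff L_smult)
  qed simp
  with assms show ?thesis by blast
qed

lemma inner_top_degree:
  assumes "degree p \<le> n"
  shows "L (q n * p) = coeff p n * L (q n * q n)"
proof -
  have "L (q n * (p - smult (coeff p n) (q n))) = 0"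
    using reduce_degree[OF assms] orthogonal_lower_degree by auto
  then show ?thesis
    by (simp add: right_diff_distrib L_diff L_smult)
qed

text \<open>The difference to \<open>q n\<close> has some degree $j < n$ and is orthogonal to \<open>q j\<close>; by
\<open>inner_top_degree\<close> its leading coefficient would then be 0.\<close>

lemma monic_orthogonal_unique:
  assumes "degree p \<le> n" and "coeff p n = 1"
    and ortho: "\<And>j. j < n \<Longrightarrow> L (q j * p) = 0"
  shows "p = q n"
proof (rule ccontr)
  assume "p \<noteq> q n"
  define r where "r = p - q n"
  have "r \<noteq> 0" using \<open>p \<noteq> q n\<close> by (simp add: r_def)
  then have less: "degree r < n"
    using reduce_degree[OF assms(1)] assms(2) by (simp add: r_def)
  let ?j = "degree r"
  have "L (q ?j * r) = L (q ?j * p) - L (q ?j * q n)"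
    by (simp add: r_def right_diff_distrib L_diff)
  also have "\<dots> = 0"
    using less ortho orthogonal by simp
  finally have "coeff r ?j * L (q ?j * q ?j) = 0"
    using inner_top_degree[of r ?j] by simp
  then show False
    using norm_pos[of ?j] \<open>r \<noteq> 0\<close> by simp
qed

end

lemma pcompose_neg_involution: "(p \<circ>\<^sub>p [:0, -1:]) \<circ>\<^sub>p [:0, -1:] = (p :: real poly)"
  by (simp add: pcompose_assoc[symmetric] pcompose_pCons)

text \<open>Composition with \<open>[:0, -1:]\<close> is the reflection $p(x) \mapsto p(-x)$.\<close>

locale symmetric_orthogonal_sequence = orthogonal_sequence +
  assumes symmetric: "L (p \<circ>\<^sub>p [:0, -1:]) = L p"
begin

text \<open>The reflection of \<open>q n\<close>, made monic, is again orthogonal to all lower degrees, so uniqueness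
applies.\<close>

lemma parity: "q n \<circ>\<^sub>p [:0, -1:] = smult ((-1) ^ n) (q n)"
proof -
  let ?r = "smult ((-1) ^ n) (q n \<circ>\<^sub>p [:0, -1:])"
  have "?r = q n"
  proof (rule monic_orthogonal_unique)
    show "degree ?r \<le> n"
      by (simp add: degree_pcompose degree_q)
    show "coeff ?r n = 1"
      by (simp add: coeff_pcompose_linear coeff_q_top power_mult_distrib[symmetric])
    fix j assume "j < n"
    have "L (q j * (q n \<circ>\<^sub>p [:0, -1:])) = L ((q n * (q j \<circ>\<^sub>p [:0, -1:])) \<circ>\<^sub>p [:0, -1:])"
      by (simp add: pcompose_mult pcompose_neg_involution mult.commute)
    also have "\<dots> = L (q n * (q j \<circ>\<^sub>p [:0, -1:]))"
      by (rule symmetric)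
    also have "\<dots> = 0"
      using \<open>j < n\<close> by (intro orthogonal_lower_degree) (simp add: degree_pcompose degree_q)
    finally show "L (q j * ?r) = 0"
      by (simp add: L_smult)
  qed
  then have "smult ((-1) ^ n) ?r = smult ((-1) ^ n) (q n)"
    by simp
  then show ?thesis
    by (simp add: power_mult_distrib[symmetric])
qed

lemma mean_zero: "L ([:0, 1:] * (q n * q n)) = 0"
proof -
  have "([:0, 1:] * (q n * q n)) \<circ>\<^sub>p [:0, -1:] = smult (-1) ([:0, 1:] * (q n * q n))"
    by (simp add: pcompose_mult parity pcompose_pCons power_mult_distrib[symmetric])
  then have "L ([:0, 1:] * (q n * q n)) = - L ([:0, 1:] * (q n * q n))"
    using symmetric[of "[:0, 1:] * (q n * q n)"] L_smult[of "-1" "[:0, 1:] * (q n * q n)"] by simp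
  then show ?thesis by simp
qed

lemma q_0: "q 0 = 1"
  using coeff_q_top[of 0] degree_q[of 0] by (auto elim!: degree_eq_zeroE simp: one_pCons)

lemma q_1: "q 1 = [:0, 1:]"
proof (rule monic_orthogonal_unique[symmetric])
  fix j :: nat assume "j < 1"
  then show "L (q j * [:0, 1:]) = 0"
    using mean_zero[of 0] by (simp add: q_0)
qed auto

text \<open>The general three-term relation has a term in \<open>q (Suc n)\<close> on the right; symmetry kills it
because its coefficient is a multiple of the integral in \<open>mean_zero\<close>.\<close>

lemma three_term:
  "[:0, 1:] * q (Suc n) =
     q (Suc (Suc n)) + smult (L (q (Suc n) * q (Suc n)) / L (q n * q n)) (q n)"
proof -
  let ?A = "L (q (Suc n) * q (Suc n)) / L (q n * q n)"
  let ?r = "[:0, 1:] * q (Suc n) - smult ?A (q n)"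
  have deg_xq: "degree ([:0, 1:] * q j) \<le> Suc j" for j
    using degree_mult_le[of "[:0, 1:]" "q j"] by (simp add: degree_q)
  have "?r = q (Suc (Suc n))"
  proof (rule monic_orthogonal_unique)
    show "degree ?r \<le> Suc (Suc n)"
      by (intro degree_diff_le deg_xq) (simp add: degree_q)
    show "coeff ?r (Suc (Suc n)) = 1"
      using coeff_q_top[of "Suc n"] by (simp add: coeff_eq_0 degree_q)
    fix j assume "j < Suc (Suc n)"
    then consider "j = Suc n" | "j = n" | "j < n" by linarith
    then show "L (q j * ?r) = 0"
    proof cases
      case 1
      then show ?thesis
        using mean_zero[of "Suc n"] orthogonal[of "Suc n" n]
        by (simp add: right_diff_distrib L_diff L_smult mult.left_commute)
    next
      case 2
      have "L (q (Suc n) * ([:0, 1:] * q n)) = L (q (Suc n) * q (Suc n))"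
        using inner_top_degree[OF deg_xq[of n]] coeff_q_top[of n] by simp
      then show ?thesis
        using 2 norm_pos[of n]
        by (simp add: right_diff_distrib L_diff L_smult mult_ac)
    next
      case 3
      have "L (q (Suc n) * ([:0, 1:] * q j)) = 0"
        using 3 deg_xq[of j] by (intro orthogonal_lower_degree) simp
      then show ?thesis
        using 3 orthogonal[of j n]
        by (simp add: right_diff_distrib L_diff L_smult mult_ac)
    qed
  qed
  then show ?thesis by (simp add: algebra_simps)
qed

text \<open>This is the squared norm of $x\,q_{n+1}$, computed by Pythagoras from its two orthogonal
components.\<close>

lemma norm_times_variable:
  "L ([:0, 0, 1:] * (q (Suc n) * q (Suc n))) =
     L (q (Suc (Suc n)) * q (Suc (Suc n))) + (L (q (Suc n) * q (Suc n)))\<^sup>2 / L (q n * q n)"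
proof -
  let ?A = "L (q (Suc n) * q (Suc n)) / L (q n * q n)"
  have "[:0, 0, 1:] * (q (Suc n) * q (Suc n)) = ([:0, 1:] * q (Suc n)) * ([:0, 1:] * q (Suc n))"
    by (simp add: mult_ac)
  also have "\<dots> = q (Suc (Suc n)) * q (Suc (Suc n))
      + smult ?A (q n * q (Suc (Suc n))) + smult ?A (q n * q (Suc (Suc n)))
      + smult (?A\<^sup>2) (q n * q n)"
    unfolding three_term
    by (simp only: distrib_left distrib_right mult_smult_left mult_smult_right smult_smult
          power2_eq_square ac_simps)
  finally have "L ([:0, 0, 1:] * (q (Suc n) * q (Suc n))) =
      L (q (Suc (Suc n)) * q (Suc (Suc n))) + ?A\<^sup>2 * L (q n * q n)"
    using orthogonal[of n "Suc (Suc n)"] by (simp only: L_add L_smult mult_zero_right add_0_right)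
  then show ?thesis
    using norm_pos[of n] by (simp add: power2_eq_square)
qed

end

text \<open>Split off the two lowest coefficients: $p(x) = a + x^2 p_2(x)$, where
$x^2 = (x^2 - c) + c$ and the induction hypothesis applies to $p_2$.\<close>

lemma even_poly_in_shifted_square:
  fixes p :: "real poly"
  assumes "\<And>n. odd n \<Longrightarrow> coeff p n = 0"
  shows "\<exists>r. p = r \<circ>\<^sub>p [:- c, 0, 1:]"
  using assms
proof (induction p rule: measure_induct_rule[of degree])
  case (less p)
  obtain a p1 where p1: "p = pCons a p1" by (cases p)
  obtain b p2 where p2: "p1 = pCons b p2" by (cases p1)
  have "b = 0"
    using less.prems[of 1] by (simp add: p1 p2)
  have odd: "coeff p2 n = 0" if "odd n" for n
    using less.prems[of "Suc (Suc n)"] that by (simp add: p1 p2)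
  have "\<exists>r. p2 = r \<circ>\<^sub>p [:- c, 0, 1:]"
  proof (cases "p2 = 0")
    case False
    then have "degree p2 < degree p" by (simp add: p1 p2)
    then show ?thesis using less.IH odd by blast
  qed (auto intro: exI[of _ 0])
  then obtain r where "p2 = r \<circ>\<^sub>p [:- c, 0, 1:]" by blast
  moreover have "p = [:a:] + [:0, 0, 1:] * p2"
    by (simp add: p1 p2 \<open>b = 0\<close>)
  moreover have "[:c, 1:] \<circ>\<^sub>p [:- c, 0, 1:] = [:0, 0, 1:]"
    by (simp add: pcompose_pCons)
  ultimately have "p = ([:a:] + [:c, 1:] * r) \<circ>\<^sub>p [:- c, 0, 1:]"
    by (simp only: pcompose_add pcompose_mult pcompose_const)
  then show ?case by blast
qed

text \<open>The passage from one level to the next: the polynomials of even degree of a symmetric law are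
the orthogonal polynomials of its image under $x \mapsto x^2 - c$.\<close>

lemma (in symmetric_orthogonal_sequence) even_subsequence:
  obtains r where "\<And>k. q (2 * k) = r k \<circ>\<^sub>p [:- c, 0, 1:]"
    and "orthogonal_sequence (\<lambda>p. L (p \<circ>\<^sub>p [:- c, 0, 1:])) r"
proof -
  have "\<exists>r. q (2 * k) = r \<circ>\<^sub>p [:- c, 0, 1:]" for k
  proof (rule even_poly_in_shifted_square)
    fix n :: nat assume "odd n"
    have "coeff (q (2 * k) \<circ>\<^sub>p [:0, -1:]) n = coeff (q (2 * k)) n"
      by (simp add: parity)
    then show "coeff (q (2 * k)) n = 0"
      using \<open>odd n\<close> by (simp add: coeff_pcompose_linear)
  qed
  then obtain r where r: "\<And>k. q (2 * k) = r k \<circ>\<^sub>p [:- c, 0, 1:]" by metis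
  have "orthogonal_sequence (\<lambda>p. L (p \<circ>\<^sub>p [:- c, 0, 1:])) r"
  proof
    fix k
    show deg: "degree (r k) = k"
      using degree_q[of "2 * k"] by (simp add: r degree_pcompose)
    show "lead_coeff (r k) = 1"
      using lead_coeff_q[of "2 * k"] unfolding r by (subst (asm) lead_coeff_comp) auto
    show "0 < L ((r k * r k) \<circ>\<^sub>p [:- c, 0, 1:])"
      using norm_pos[of "2 * k"] by (simp add: r pcompose_mult)
  next
    fix m n :: nat assume "m \<noteq> n"
    then show "L ((r m * r n) \<circ>\<^sub>p [:- c, 0, 1:]) = 0"
      using orthogonal[of "2 * m" "2 * n"] by (simp add: r pcompose_mult)
  qed (simp_all add: pcompose_add pcompose_smult L_add L_smult)
  with r that show thesis by blast
qed

section \<open>Positivity of the logarithmic energy\<close>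

text \<open>For points of a set of diameter at most 1 the kernel $\log (1/|x-y|)$ is nonnegative, so
energies can be computed with nonnegative integrals only.\<close>

definition lk :: "real \<Rightarrow> real \<Rightarrow> ennreal" where
  "lk x y = e2ennreal (log_kernel x y)"

definition mutual_energy :: "real measure \<Rightarrow> real measure \<Rightarrow> ennreal" where
  "mutual_energy \<mu> \<nu> = (\<integral>\<^sup>+ x. \<integral>\<^sup>+ y. lk x y \<partial>\<nu> \<partial>\<mu>)"

lemma lk_eq: "lk x y = (if x = y then \<top> else ennreal (- ln \<bar>x - y\<bar>))"
  by (simp add: lk_def log_kernel_def ln_div)

lemma lk_commute: "lk x y = lk y x"
  by (simp add: lk_eq abs_minus_commute)

lemma lk_measurable [measurable]: "(\<lambda>(x, y). lk x y) \<in> borel_measurable (borel \<Otimes>\<^sub>M borel)"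
  unfolding lk_eq by measurable

lemma prob_measures_onD:
  assumes "\<mu> \<in> prob_measures_on K"
  shows "prob_space \<mu>" "sets \<mu> = sets borel" "K \<in> sets borel" "AE x in \<mu>. x \<in> K"
proof -
  show p: "prob_space \<mu>" and s: "sets \<mu> = sets borel"
    using assms by (auto simp: prob_measures_on_def)
  have e: "emeasure \<mu> K = 1"
    using assms by (auto simp: prob_measures_on_def)
  then show "K \<in> sets borel"
    using emeasure_notin_sets[of K \<mu>] s by fastforce
  interpret prob_space \<mu> by fact
  show "AE x in \<mu>. x \<in> K"
    using e \<open>K \<in> sets borel\<close> s by (intro AE_prob_1) (simp add: measure_def)
qed

lemma prob_measures_onI:
  assumes "prob_space \<mu>" "sets \<mu> = sets borel" "K \<in> sets borel" "AE x in \<mu>. x \<in> K"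
  shows "\<mu> \<in> prob_measures_on K"
proof -
  interpret prob_space \<mu> by fact
  show ?thesis
    using assms prob_eq_1[of K] by (auto simp: prob_measures_on_def emeasure_eq_measure)
qed

lemma nn_integral_cong_on_carrier:
  assumes "AE x in \<mu>. x \<in> K" "AE y in \<nu>. y \<in> K"
    and "\<And>x y. x \<in> K \<Longrightarrow> y \<in> K \<Longrightarrow> f x y = g x y"
  shows "(\<integral>\<^sup>+ x. \<integral>\<^sup>+ y. f x y \<partial>\<nu> \<partial>\<mu>) = (\<integral>\<^sup>+ x. \<integral>\<^sup>+ y. g x y \<partial>\<nu> \<partial>\<mu>)"
proof (rule nn_integral_cong_AE)
  from assms(1) show "AE x in \<mu>. (\<integral>\<^sup>+ y. f x y \<partial>\<nu>) = (\<integral>\<^sup>+ y. g x y \<partial>\<nu>)"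
  proof eventually_elim
    case (elim x)
    from assms(2) have "AE y in \<nu>. f x y = g x y"
      by eventually_elim (use elim assms(3) in simp)
    then show ?case by (rule nn_integral_cong_AE)
  qed
qed

lemma log_energy_eq_mutual:
  assumes mu: "\<mu> \<in> prob_measures_on K" and "K \<subseteq> {0..1}"
  shows "log_energy \<mu> = enn2ereal (mutual_energy \<mu> \<mu>)"
proof -
  note D = prob_measures_onD[OF mu]
  have *: "e2ennreal (- log_kernel x y) = 0" if "x \<in> K" "y \<in> K" for x y
  proof -
    have "\<bar>x - y\<bar> \<le> 1" using that by (auto simp: abs_le_iff dest!: subsetD[OF \<open>K \<subseteq> {0..1}\<close>])
    then show ?thesis by (auto simp: log_kernel_def ln_div e2ennreal_neg)
  qed
  have "(\<integral>\<^sup>+ x. \<integral>\<^sup>+ y. e2ennreal (- log_kernel x y) \<partial>\<mu> \<partial>\<mu>) = (\<integral>\<^sup>+ x. \<integral>\<^sup>+ y. 0 \<partial>\<mu> \<partial>\<mu>)"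
    by (rule nn_integral_cong_on_carrier[OF D(4) D(4) *])
  then show ?thesis
    by (simp add: log_energy_def mutual_energy_def lk_def zero_ennreal.rep_eq)
qed

text \<open>Tonelli. For $\nu = \mu$ the right-hand side is an integral of squares, which is what makes a
kernel of this form positive definite.\<close>

lemma nn_integral_product_kernel:
  fixes \<phi> :: "'a \<Rightarrow> real \<Rightarrow> ennreal"
  assumes "sigma_finite_measure M" "prob_space \<mu>" "prob_space \<nu>"
    and sets: "sets \<mu> = sets borel" "sets \<nu> = sets borel"
    and meas: "case_prod \<phi> \<in> borel_measurable (M \<Otimes>\<^sub>M borel)"
  shows "(\<integral>\<^sup>+ x. \<integral>\<^sup>+ y. \<integral>\<^sup>+ m. \<phi> m x * \<phi> m y \<partial>M \<partial>\<nu> \<partial>\<mu>) =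
    (\<integral>\<^sup>+ m. (\<integral>\<^sup>+ x. \<phi> m x \<partial>\<mu>) * (\<integral>\<^sup>+ y. \<phi> m y \<partial>\<nu>) \<partial>M)"
proof -
  interpret M: sigma_finite_measure M by fact
  interpret mu: prob_space \<mu> by fact
  interpret nu: prob_space \<nu> by fact
  interpret Mmu: pair_sigma_finite M \<mu> ..
  interpret Mnu: pair_sigma_finite M \<nu> ..
  note [measurable_cong] = sets
  note [measurable] = meas
  have [measurable]: "(\<lambda>m. \<integral>\<^sup>+ y. \<phi> m y \<partial>\<nu>) \<in> borel_measurable M"
    by measurable
  have "(\<integral>\<^sup>+ y. \<integral>\<^sup>+ m. \<phi> m x * \<phi> m y \<partial>M \<partial>\<nu>) = (\<integral>\<^sup>+ m. \<phi> m x * (\<integral>\<^sup>+ y. \<phi> m y \<partial>\<nu>) \<partial>M)" for x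
  proof -
    have "(\<integral>\<^sup>+ y. \<integral>\<^sup>+ m. \<phi> m x * \<phi> m y \<partial>M \<partial>\<nu>) = (\<integral>\<^sup>+ m. \<integral>\<^sup>+ y. \<phi> m x * \<phi> m y \<partial>\<nu> \<partial>M)"
      by (rule Mnu.Fubini') measurable
    also have "\<dots> = (\<integral>\<^sup>+ m. \<phi> m x * (\<integral>\<^sup>+ y. \<phi> m y \<partial>\<nu>) \<partial>M)"
      by (intro nn_integral_cong nn_integral_cmult) measurable
    finally show ?thesis .
  qed
  then have "(\<integral>\<^sup>+ x. \<integral>\<^sup>+ y. \<integral>\<^sup>+ m. \<phi> m x * \<phi> m y \<partial>M \<partial>\<nu> \<partial>\<mu>) =
      (\<integral>\<^sup>+ x. \<integral>\<^sup>+ m. \<phi> m x * (\<integral>\<^sup>+ y. \<phi> m y \<partial>\<nu>) \<partial>M \<partial>\<mu>)"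
    by simp
  also have "\<dots> = (\<integral>\<^sup>+ m. \<integral>\<^sup>+ x. \<phi> m x * (\<integral>\<^sup>+ y. \<phi> m y \<partial>\<nu>) \<partial>\<mu> \<partial>M)"
    by (rule Mmu.Fubini') measurable
  also have "\<dots> = (\<integral>\<^sup>+ m. (\<integral>\<^sup>+ x. \<phi> m x \<partial>\<mu>) * (\<integral>\<^sup>+ y. \<phi> m y \<partial>\<nu>) \<partial>M)"
    by (intro nn_integral_cong nn_integral_multc) measurable
  finally show ?thesis .
qed

lemma ennreal_two_mult_le: "2 * (a * b) \<le> a * a + b * (b :: ennreal)"
proof (cases a; cases b)
  fix r s assume "a = ennreal r" "0 \<le> r" "b = ennreal s" "0 \<le> s"
  moreover have "2 * (r * s) \<le> r * r + s * s"
    using zero_le_power2[of "r - s"] by (simp add: power2_eq_square algebra_simps)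
  ultimately show ?thesis
    by (simp flip: ennreal_mult ennreal_plus ennreal_numeral)
qed (auto simp: ennreal_mult_top ennreal_top_mult)

lemma window_overlap:
  fixes x y h :: real
  shows "(\<integral>\<^sup>+ u. indicator {u<..u+h} x * indicator {u<..u+h} y \<partial>lborel) = ennreal (h - \<bar>x - y\<bar>)"
proof -
  have "(\<lambda>u. indicator {u<..u+h} x * indicator {u<..u+h} y :: ennreal) =
      indicator {max x y - h ..< min x y}"
    by (auto simp: indicator_def fun_eq_iff max_def min_def)
  then have "(\<integral>\<^sup>+ u. indicator {u<..u+h} x * indicator {u<..u+h} y \<partial>lborel) =
      emeasure lborel {max x y - h ..< min x y}"
    by simp
  also have "\<dots> = ennreal (h - \<bar>x - y\<bar>)"
  proof (cases "max x y - h \<le> min x y")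
    case True
    then have "emeasure lborel {max x y - h ..< min x y} = ennreal (min x y - (max x y - h))"
      by simp
    also have "min x y - (max x y - h) = h - \<bar>x - y\<bar>"
      by (auto simp: max_def min_def)
    finally show ?thesis .
  next
    case False
    then have "h - \<bar>x - y\<bar> \<le> 0" by (auto simp: max_def min_def split: if_splits)
    then show ?thesis using False by (simp add: ennreal_neg)
  qed
  finally show ?thesis .
qed

text \<open>A mixture of the positive definite kernels $(h-d)_+$ over all scales $h \le 1$ reproduces the
logarithm: $\int_d^1 (h-d)\,h^{-2}\,dh = d - 1 - \log d$. The left-over $1 - d$ is the scale
$h = 1$ taken with unit weight.\<close>

lemma nn_integral_scales:
  fixes d :: real
  assumes "0 \<le> d" "d \<le> 1"
  shows "ennreal (1 - d) +
      (\<integral>\<^sup>+ h. (if 0 < h \<and> h \<le> 1 then ennreal ((h - d) / h\<^sup>2) else 0) \<partial>lborel) =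
    (if d = 0 then \<top> else ennreal (- ln d))"
proof -
  have FTC: "(\<integral>\<^sup>+ h. ennreal ((h - d) / h\<^sup>2) * indicator {e..1} h \<partial>lborel) = ennreal (d - ln e - d / e)"
    if e: "0 < e" "d \<le> e" "e \<le> 1" for e
  proof -
    have "(\<integral>\<^sup>+ h. ennreal ((h - d) / h\<^sup>2) * indicator {e..1} h \<partial>lborel) =
        ennreal ((ln 1 + d / 1) - (ln e + d / e))"
    proof (rule nn_integral_FTC_Icc)
      fix h assume "h \<in> {e..1}"
      then have h: "e \<le> h" "h \<le> 1" by auto
      then show "((\<lambda>h. ln h + d / h) has_real_derivative (h - d) / h\<^sup>2) (at h)"
        using e by (auto intro!: derivative_eq_intros simp: field_simps power2_eq_square)
      show "0 \<le> (h - d) / h\<^sup>2" using h e by simp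
    qed (use e in auto)
    then show ?thesis by (simp add: algebra_simps)
  qed
  show ?thesis
  proof (cases "d = 0")
    case False
    then have "d > 0" using assms by simp
    have "(\<integral>\<^sup>+ h. (if 0 < h \<and> h \<le> 1 then ennreal ((h - d) / h\<^sup>2) else 0) \<partial>lborel) =
        (\<integral>\<^sup>+ h. ennreal ((h - d) / h\<^sup>2) * indicator {d..1} h \<partial>lborel)"
      using \<open>d > 0\<close> by (intro nn_integral_cong) (auto simp: indicator_def ennreal_neg divide_le_0_iff)
    also have "\<dots> = ennreal (d - ln d - 1)"
      using FTC[of d] \<open>d > 0\<close> assms by simp
    finally show ?thesis
      using \<open>d > 0\<close> assms ln_le_minus_one[of d] by (simp flip: ennreal_plus)
  next
    case True
    \<comment> \<open>On the diagonal the integral diverges: the part above the scale \<open>e\<close> contributes \<open>- ln e\<close>.\<close>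
    let ?I = "\<integral>\<^sup>+ h. (if 0 < h \<and> h \<le> 1 then ennreal ((h - d) / h\<^sup>2) else 0) \<partial>lborel"
    have "?I = \<top>"
    proof (rule ccontr)
      assume "?I \<noteq> \<top>"
      then obtain r where r: "?I = ennreal r" "0 \<le> r" by (cases ?I) auto
      have "ennreal (r + 1) = (\<integral>\<^sup>+ h. ennreal ((h - d) / h\<^sup>2) * indicator {exp (- (r + 1))..1} h \<partial>lborel)"
        using FTC[of "exp (- (r + 1))"] True r(2) by simp
      also have "\<dots> \<le> ?I"
        by (intro nn_integral_mono) (auto simp: indicator_def intro: less_le_trans[OF exp_gt_zero])
      finally show False using r by simp
    qed
    then show ?thesis using True by simp
  qed
qed

text \<open>The window $(u,u+h]$ at $p = (h,u)$. Each of the two factors of a product kernel carries the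
weight $1/h$, which gives the weight $h^{-2}$ of \<open>nn_integral_scales\<close>.\<close>

definition scale_window :: "real \<times> real \<Rightarrow> real \<Rightarrow> ennreal" where
  "scale_window p x = (if 0 < fst p \<and> fst p \<le> 1
     then ennreal (1 / fst p) * indicator {snd p<..snd p + fst p} x else 0)"

lemma scale_window_measurable [measurable]:
  "case_prod scale_window \<in> borel_measurable ((lborel \<Otimes>\<^sub>M lborel) \<Otimes>\<^sub>M borel)"
  unfolding scale_window_def greaterThanAtMost_iff indicator_def by measurable

lemma unit_window_measurable [measurable]:
  "(\<lambda>(u, x). indicator {u<..u+1} x :: ennreal) \<in> borel_measurable (lborel \<Otimes>\<^sub>M (borel :: real measure))"
  unfolding greaterThanAtMost_iff indicator_def by measurable

lemma lk_windows:
  assumes "\<bar>x - y\<bar> \<le> 1"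
  shows "lk x y = (\<integral>\<^sup>+ u. indicator {u<..u+1} x * indicator {u<..u+1} y \<partial>lborel) +
    (\<integral>\<^sup>+ p. scale_window p x * scale_window p y \<partial>(lborel \<Otimes>\<^sub>M lborel))"
proof -
  have "(\<integral>\<^sup>+ p. scale_window p x * scale_window p y \<partial>(lborel \<Otimes>\<^sub>M lborel)) =
      (\<integral>\<^sup>+ h. \<integral>\<^sup>+ u. scale_window (h, u) x * scale_window (h, u) y \<partial>lborel \<partial>lborel)"
    by (rule lborel.nn_integral_fst[symmetric]) measurable
  also have "\<dots> = (\<integral>\<^sup>+ h. (if 0 < h \<and> h \<le> 1 then ennreal ((h - \<bar>x - y\<bar>) / h\<^sup>2) else 0) \<partial>lborel)"
  proof (intro nn_integral_cong)
    fix h :: real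
    show "(\<integral>\<^sup>+ u. scale_window (h, u) x * scale_window (h, u) y \<partial>lborel) =
        (if 0 < h \<and> h \<le> 1 then ennreal ((h - \<bar>x - y\<bar>) / h\<^sup>2) else 0)"
    proof (cases "0 < h \<and> h \<le> 1")
      case True
      have "(\<integral>\<^sup>+ u. scale_window (h, u) x * scale_window (h, u) y \<partial>lborel) =
          (\<integral>\<^sup>+ u. ennreal (1 / h\<^sup>2) * (indicator {u<..u+h} x * indicator {u<..u+h} y) \<partial>lborel)"
        using True by (intro nn_integral_cong)
          (auto simp: scale_window_def indicator_def power2_eq_square simp flip: ennreal_mult)
      also have "\<dots> = ennreal (1 / h\<^sup>2) * (\<integral>\<^sup>+ u. indicator {u<..u+h} x * indicator {u<..u+h} y \<partial>lborel)"
        unfolding greaterThanAtMost_iff indicator_def by (rule nn_integral_cmult) measurable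
      also have "\<dots> = ennreal (1 / h\<^sup>2) * ennreal (h - \<bar>x - y\<bar>)"
        by (simp only: window_overlap)
      also have "\<dots> = ennreal ((h - \<bar>x - y\<bar>) / h\<^sup>2)"
        by (simp flip: ennreal_mult')
      finally show ?thesis using True by simp
    next
      case False
      then have "scale_window (h, u) x = 0" for u using False by (auto simp: scale_window_def)
      then show ?thesis using False by auto
    qed
  qed
  finally show ?thesis
    using nn_integral_scales[of "\<bar>x - y\<bar>"] assms by (simp add: window_overlap lk_eq)
qed

text \<open>The measure $(\mu+\nu)/2$, which exists in the Giry monad as the law obtained by tossing a fair
coin between the two.\<close>

definition fair_mixture :: "real measure \<Rightarrow> real measure \<Rightarrow> real measure" where
  "fair_mixture \<mu> \<nu> = measure_pmf (bernoulli_pmf (1/2)) \<bind> (\<lambda>b. if b then \<mu> else \<nu>)"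

lemma fair_mixture:
  assumes "prob_space \<mu>" "prob_space \<nu>" "sets \<mu> = sets borel" "sets \<nu> = sets borel"
  shows sets_fair_mixture: "sets (fair_mixture \<mu> \<nu>) = sets borel"
    and prob_space_fair_mixture: "prob_space (fair_mixture \<mu> \<nu>)"
    and nn_integral_fair_mixture: "f \<in> borel_measurable borel \<Longrightarrow>
      2 * (\<integral>\<^sup>+ x. f x \<partial>fair_mixture \<mu> \<nu>) = (\<integral>\<^sup>+ x. f x \<partial>\<mu>) + (\<integral>\<^sup>+ x. f x \<partial>\<nu>)"
proof -
  have "\<mu> \<in> space (prob_algebra borel)" "\<nu> \<in> space (prob_algebra borel)"
    using assms by (auto simp: space_prob_algebra)
  then have kernel: "(\<lambda>b. if b then \<mu> else \<nu>) \<in> measure_pmf (bernoulli_pmf (1/2)) \<rightarrow>\<^sub>M prob_algebra borel"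
    by (simp add: measurable_def)
  show sets: "sets (fair_mixture \<mu> \<nu>) = sets borel"
    unfolding fair_mixture_def using assms by (intro sets_bind) auto
  show "prob_space (fair_mixture \<mu> \<nu>)"
    unfolding fair_mixture_def
    by (rule prob_space_bind'[OF _ kernel]) (auto simp: space_prob_algebra prob_space_measure_pmf)
  assume f: "f \<in> borel_measurable borel"
  have "(\<integral>\<^sup>+ x. f x \<partial>fair_mixture \<mu> \<nu>) =
      (\<integral>\<^sup>+ b. \<integral>\<^sup>+ x. f x \<partial>(if b then \<mu> else \<nu>) \<partial>measure_pmf (bernoulli_pmf (1/2)))"
    unfolding fair_mixture_def
    by (rule nn_integral_bind[OF f measurable_prob_algebraD[OF kernel]])
  also have "\<dots> = (\<integral>\<^sup>+ x. f x \<partial>\<mu>) * ennreal (1/2) + (\<integral>\<^sup>+ x. f x \<partial>\<nu>) * ennreal (1/2)"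
    by (subst nn_integral_bernoulli_pmf) auto
  finally have eq: "(\<integral>\<^sup>+ x. f x \<partial>fair_mixture \<mu> \<nu>) =
      ((\<integral>\<^sup>+ x. f x \<partial>\<mu>) + (\<integral>\<^sup>+ x. f x \<partial>\<nu>)) * ennreal (1/2)"
    by (simp add: distrib_right)
  have "2 * ennreal (1/2) = 1"
    using ennreal_mult[of 2 "1/2"] by simp
  then have "2 * (a * ennreal (1/2)) = a" for a
    by (simp only: mult.left_commute[of 2] mult_1_right)
  then show "2 * (\<integral>\<^sup>+ x. f x \<partial>fair_mixture \<mu> \<nu>) = (\<integral>\<^sup>+ x. f x \<partial>\<mu>) + (\<integral>\<^sup>+ x. f x \<partial>\<nu>)"
    unfolding eq by blast
qed

lemma mutual_energy_commute:
  assumes "prob_space \<mu>" "prob_space \<nu>" and sets: "sets \<mu> = sets borel" "sets \<nu> = sets borel"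
  shows "mutual_energy \<mu> \<nu> = mutual_energy \<nu> \<mu>"
proof -
  interpret mu: prob_space \<mu> by fact
  interpret nu: prob_space \<nu> by fact
  interpret pair_sigma_finite \<mu> \<nu> ..
  note [measurable_cong] = sets
  have "(\<integral>\<^sup>+ x. \<integral>\<^sup>+ y. lk x y \<partial>\<nu> \<partial>\<mu>) = (\<integral>\<^sup>+ y. \<integral>\<^sup>+ x. lk x y \<partial>\<mu> \<partial>\<nu>)"
    by (rule Fubini'[symmetric]) measurable
  also have "\<dots> = (\<integral>\<^sup>+ y. \<integral>\<^sup>+ x. lk y x \<partial>\<mu> \<partial>\<nu>)"
    by (simp add: lk_commute)
  finally show ?thesis by (simp add: mutual_energy_def)
qed

lemma mutual_energy_fair_mixture:
  assumes "prob_space \<mu>" "prob_space \<nu>" and sets: "sets \<mu> = sets borel" "sets \<nu> = sets borel"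
  shows "4 * mutual_energy (fair_mixture \<mu> \<nu>) (fair_mixture \<mu> \<nu>) =
    mutual_energy \<mu> \<mu> + 2 * mutual_energy \<mu> \<nu> + mutual_energy \<nu> \<nu>"
proof -
  interpret mu: prob_space \<mu> by fact
  interpret nu: prob_space \<nu> by fact
  interpret rho: prob_space "fair_mixture \<mu> \<nu>"
    by (rule prob_space_fair_mixture[OF assms])
  note [measurable_cong] = sets sets_fair_mixture[OF assms]
  let ?\<rho> = "fair_mixture \<mu> \<nu>"
  have inner: "2 * (\<integral>\<^sup>+ y. lk x y \<partial>?\<rho>) = (\<integral>\<^sup>+ y. lk x y \<partial>\<mu>) + (\<integral>\<^sup>+ y. lk x y \<partial>\<nu>)" for x
    by (rule nn_integral_fair_mixture[OF assms]) measurable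
  have outer: "2 * mutual_energy ?\<rho> ?\<rho> = mutual_energy \<mu> ?\<rho> + mutual_energy \<nu> ?\<rho>"
    unfolding mutual_energy_def by (rule nn_integral_fair_mixture[OF assms]) measurable
  have "2 * mutual_energy \<tau> ?\<rho> = mutual_energy \<tau> \<mu> + mutual_energy \<tau> \<nu>"
    if [measurable_cong]: "sets \<tau> = sets borel" for \<tau>
  proof -
    have "2 * mutual_energy \<tau> ?\<rho> = (\<integral>\<^sup>+ x. 2 * (\<integral>\<^sup>+ y. lk x y \<partial>?\<rho>) \<partial>\<tau>)"
      unfolding mutual_energy_def by (rule nn_integral_cmult[symmetric]) measurable
    also have "\<dots> = mutual_energy \<tau> \<mu> + mutual_energy \<tau> \<nu>"
      unfolding inner mutual_energy_def by (rule nn_integral_add) measurable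
    finally show ?thesis .
  qed
  from this[OF sets(1)] this[OF sets(2)] 
  have "2 * mutual_energy \<mu> ?\<rho> + 2 * mutual_energy \<nu> ?\<rho> =
      mutual_energy \<mu> \<mu> + 2 * mutual_energy \<mu> \<nu> + mutual_energy \<nu> \<nu>"
    by (simp add: mult_2 mult_2_right ac_simps mutual_energy_commute[OF assms])
  moreover have "4 * mutual_energy ?\<rho> ?\<rho> = 2 * (2 * mutual_energy ?\<rho> ?\<rho>)"
    by (simp flip: mult.assoc)
  ultimately show ?thesis
    unfolding outer by (simp add: distrib_left)
qed

lemma mutual_energy_windows:
  assumes mu: "\<mu> \<in> prob_measures_on K" and nu: "\<nu> \<in> prob_measures_on K" and K: "K \<subseteq> {0..1}"
  shows "mutual_energy \<mu> \<nu> =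
      (\<integral>\<^sup>+ u. emeasure \<mu> {u<..u+1} * emeasure \<nu> {u<..u+1} \<partial>lborel) +
      (\<integral>\<^sup>+ p. (\<integral>\<^sup>+ x. scale_window p x \<partial>\<mu>) * (\<integral>\<^sup>+ x. scale_window p x \<partial>\<nu>) \<partial>(lborel \<Otimes>\<^sub>M lborel))"
proof -
  note M = prob_measures_onD[OF mu] and N = prob_measures_onD[OF nu]
  interpret mu: prob_space \<mu> by fact
  interpret nu: prob_space \<nu> by fact
  interpret L2: pair_sigma_finite "lborel :: real measure" "lborel :: real measure" ..
  note [measurable_cong] = M(2) N(2)
  have "mutual_energy \<mu> \<nu> = (\<integral>\<^sup>+ x. \<integral>\<^sup>+ y.
      (\<integral>\<^sup>+ u. indicator {u<..u+1} x * indicator {u<..u+1} y \<partial>lborel) +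
      (\<integral>\<^sup>+ p. scale_window p x * scale_window p y \<partial>(lborel \<Otimes>\<^sub>M lborel)) \<partial>\<nu> \<partial>\<mu>)"
    unfolding mutual_energy_def
    by (intro nn_integral_cong_on_carrier[OF M(4) N(4)] lk_windows)
      (auto simp: abs_le_iff dest!: subsetD[OF K])
  also have "\<dots> = (\<integral>\<^sup>+ x. (\<integral>\<^sup>+ y. \<integral>\<^sup>+ u. indicator {u<..u+1} x * indicator {u<..u+1} y \<partial>lborel \<partial>\<nu>) +
      (\<integral>\<^sup>+ y. \<integral>\<^sup>+ p. scale_window p x * scale_window p y \<partial>(lborel \<Otimes>\<^sub>M lborel) \<partial>\<nu>) \<partial>\<mu>)"
    by (intro nn_integral_cong nn_integral_add) measurable
  also have "\<dots> = (\<integral>\<^sup>+ x. \<integral>\<^sup>+ y. \<integral>\<^sup>+ u. indicator {u<..u+1} x * indicator {u<..u+1} y \<partial>lborel \<partial>\<nu> \<partial>\<mu>) +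
      (\<integral>\<^sup>+ x. \<integral>\<^sup>+ y. \<integral>\<^sup>+ p. scale_window p x * scale_window p y \<partial>(lborel \<Otimes>\<^sub>M lborel) \<partial>\<nu> \<partial>\<mu>)"
    by (intro nn_integral_add) measurable
  also have "(\<integral>\<^sup>+ x. \<integral>\<^sup>+ y. \<integral>\<^sup>+ u. indicator {u<..u+1} x * indicator {u<..u+1} y \<partial>lborel \<partial>\<nu> \<partial>\<mu>) =
      (\<integral>\<^sup>+ u. emeasure \<mu> {u<..u+1} * emeasure \<nu> {u<..u+1} \<partial>lborel)"
    using nn_integral_product_kernel[of lborel \<mu> \<nu> "\<lambda>u. indicator {u<..u+1}"] M N
    by (simp add: lborel.sigma_finite_measure_axioms)
  also have "(\<integral>\<^sup>+ x. \<integral>\<^sup>+ y. \<integral>\<^sup>+ p. scale_window p x * scale_window p y \<partial>(lborel \<Otimes>\<^sub>M lborel) \<partial>\<nu> \<partial>\<mu>) =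
      (\<integral>\<^sup>+ p. (\<integral>\<^sup>+ x. scale_window p x \<partial>\<mu>) * (\<integral>\<^sup>+ x. scale_window p x \<partial>\<nu>) \<partial>(lborel \<Otimes>\<^sub>M lborel))"
    by (rule nn_integral_product_kernel)
      (use M N scale_window_measurable in \<open>auto intro: lborel_pair.sigma_finite_measure_axioms\<close>)
  finally show ?thesis .
qed

text \<open>For $u < 0$ the window $(u,u+1]$ cuts a measure on $[0,1]$ at $u + 1$ only, so its mass is the
distribution function at $u + 1$. Right continuity turns equality almost everywhere into
equality.\<close>

lemma eq_if_unit_windows_eq:
  assumes mu: "\<mu> \<in> prob_measures_on K" and nu: "\<nu> \<in> prob_measures_on K" and K: "K \<subseteq> {0..1}"
    and eq: "AE u in lborel. emeasure \<mu> {u<..u+1} = emeasure \<nu> {u<..u+1}"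
  shows "\<mu> = \<nu>"
proof -
  note M = prob_measures_onD[OF mu] and N = prob_measures_onD[OF nu]
  interpret mu: real_distribution \<mu>
    using M by (intro real_distribution.intro real_distribution_axioms.intro)
  interpret nu: real_distribution \<nu>
    using N by (intro real_distribution.intro real_distribution_axioms.intro)
  have window: "emeasure \<tau> {u<..u+1} = emeasure \<tau> {..u+1}"
    if "u < 0" "\<tau> \<in> prob_measures_on K" for u \<tau>
  proof (rule emeasure_eq_AE)
    note T = prob_measures_onD[OF that(2)]
    show "AE x in \<tau>. (x \<in> {u<..u+1}) = (x \<in> {..u+1})"
      using T(4) by eventually_elim (use K \<open>u < 0\<close> in fastforce)
    show "{u<..u+1} \<in> sets \<tau>" "{..u+1} \<in> sets \<tau>" using T(2) by auto
  qed
  have "cdf \<mu> t = cdf \<nu> t" for t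
  proof (cases "0 \<le> t \<and> t < 1")
    case False
    have "cdf \<tau> t = (if t < 0 then 0 else 1)" if "\<tau> \<in> prob_measures_on K" for \<tau>
    proof -
      note T = prob_measures_onD[OF that]
      interpret tau: prob_space \<tau> by fact
      have S: "{..t} \<in> sets \<tau>" using T(2) by simp
      show ?thesis
      proof (cases "t < 0")
        case True
        have "AE x in \<tau>. x \<notin> {..t}"
          using T(4) by eventually_elim (use K True in force)
        then have "tau.prob {..t} = 0" using S by (simp add: tau.prob_eq_0)
        then show ?thesis using True by (simp add: cdf_def)
      next
        case f: False
        have "AE x in \<tau>. x \<in> {..t}"
          using T(4) by eventually_elim (use K f False in force)
        then have "tau.prob {..t} = 1" using S by (simp add: tau.prob_eq_1)
        then show ?thesis using f by (simp add: cdf_def)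
      qed
    qed
    then show ?thesis using mu nu by simp
  next
    case True
    show ?thesis
    proof (rule ccontr)
      assume neq: "cdf \<mu> t \<noteq> cdf \<nu> t"
      have "((\<lambda>x. cdf \<mu> x - cdf \<nu> x) \<longlongrightarrow> cdf \<mu> t - cdf \<nu> t) (at_right t)"
        using mu.cdf_is_right_cont[of t] nu.cdf_is_right_cont[of t]
        by (intro tendsto_diff) (auto simp: continuous_within)
      then have "eventually (\<lambda>x. cdf \<mu> x - cdf \<nu> x \<noteq> 0) (at_right t)"
        by (rule tendsto_imp_eventually_ne) (use neq in simp)
      then obtain b where b: "t < b" "\<And>x. t < x \<Longrightarrow> x < b \<Longrightarrow> cdf \<mu> x \<noteq> cdf \<nu> x"
        unfolding eventually_at_right_field by auto
      let ?I = "{t - 1<..<min b 1 - 1}"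
      have "AE u in lborel. u \<notin> ?I"
        using eq
      proof eventually_elim
        case (elim u)
        show ?case
        proof
          assume u: "u \<in> ?I"
          then have "emeasure \<mu> {..u+1} = emeasure \<nu> {..u+1}"
            using elim window[of u \<mu>] window[of u \<nu>] mu nu by auto
          then have "cdf \<mu> (u + 1) = cdf \<nu> (u + 1)"
            by (simp add: cdf_def measure_def)
          with b(2)[of "u + 1"] u show False by (simp add: less_diff_eq)
        qed
      qed
      then have "emeasure lborel ?I = 0"
        by (subst (asm) AE_iff_measurable[of ?I]) auto
      then show False
        using \<open>t < b\<close> True by (simp add: min_def split: if_splits)
    qed
  qed
  then show ?thesis
    by (intro cdf_unique mu.real_distribution_axioms nu.real_distribution_axioms ext)
qed

text \<open>Strict convexity. Since the midpoint of \<open>\<mu>\<close> and \<open>\<nu>\<close> has at least the minimal energy, their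
mutual energy is at least as large as the common energy of both. Every window contributes
$2ab \le a^2 + b^2$ in the opposite direction, so equality holds for almost every window; the
windows of length 1 suffice to identify the measures.\<close>

lemma energy_minimizer_unique:
  assumes mu: "\<mu> \<in> prob_measures_on K" and nu: "\<nu> \<in> prob_measures_on K" and K: "K \<subseteq> {0..1}"
    and min: "log_energy \<mu> = min_energy K" and finite: "min_energy K \<noteq> \<infinity>"
    and same: "mutual_energy \<nu> \<nu> = mutual_energy \<mu> \<mu>"
  shows "\<mu> = \<nu>"
proof -
  note M = prob_measures_onD[OF mu] and N = prob_measures_onD[OF nu]
  interpret mu: prob_space \<mu> by fact
  interpret nu: prob_space \<nu> by fact
  note [measurable_cong] = M(2) N(2)
  define A where "A = (\<lambda>\<mu> \<nu>. \<integral>\<^sup>+ u. emeasure \<mu> {u<..u+1} * emeasure \<nu> {u<..u+1} \<partial>(lborel :: real measure))"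
  define B where "B = (\<lambda>\<mu> \<nu>. \<integral>\<^sup>+ p. (\<integral>\<^sup>+ x. scale_window p x \<partial>\<mu>) *
      (\<integral>\<^sup>+ x. scale_window p x \<partial>\<nu>) \<partial>(lborel \<Otimes>\<^sub>M lborel))"
  have split: "mutual_energy \<alpha> \<beta> = A \<alpha> \<beta> + B \<alpha> \<beta>"
    if "\<alpha> \<in> prob_measures_on K" "\<beta> \<in> prob_measures_on K" for \<alpha> \<beta>
    unfolding A_def B_def using that K by (rule mutual_energy_windows)
  have V: "mutual_energy \<mu> \<mu> \<noteq> \<top>"
    using finite min log_energy_eq_mutual[OF mu K] by auto
  let ?\<rho> = "fair_mixture \<mu> \<nu>"
  have rho: "?\<rho> \<in> prob_measures_on K"
  proof (rule prob_measures_onI)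
    show s: "sets ?\<rho> = sets borel" and p: "prob_space ?\<rho>" and "K \<in> sets borel"
      using fair_mixture[OF M(1) N(1) M(2) N(2)] M(3) by auto
    have "2 * (\<integral>\<^sup>+ x. indicator (- K) x \<partial>?\<rho>) = (\<integral>\<^sup>+ x. indicator (- K) x \<partial>\<mu>) + (\<integral>\<^sup>+ x. indicator (- K) x \<partial>\<nu>)"
      using M(3) by (intro nn_integral_fair_mixture M N borel_measurable_indicator) auto
    also have "(\<integral>\<^sup>+ x. indicator (- K) x \<partial>\<mu>) = (\<integral>\<^sup>+ x. 0 \<partial>\<mu>)"
      by (intro nn_integral_cong_AE) (use M(4) in \<open>auto elim!: eventually_mono\<close>)
    also have "(\<integral>\<^sup>+ x. indicator (- K) x \<partial>\<nu>) = (\<integral>\<^sup>+ x. 0 \<partial>\<nu>)"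
      by (intro nn_integral_cong_AE) (use N(4) in \<open>auto elim!: eventually_mono\<close>)
    finally have "emeasure ?\<rho> (- K) = 0"
      using M(3) s by (simp add: borel_comp)
    then show "AE x in ?\<rho>. x \<in> K"
      using M(3) s by (intro AE_I[of _ _ "- K"]) (auto simp: borel_comp)
  qed
  have "min_energy K \<le> log_energy ?\<rho>"
    unfolding min_energy_def using rho by (rule INF_lower)
  then have "mutual_energy \<mu> \<mu> \<le> mutual_energy ?\<rho> ?\<rho>"
    using min by (simp add: log_energy_eq_mutual[OF mu K] log_energy_eq_mutual[OF rho K]
        less_eq_ennreal.rep_eq)
  then have "4 * mutual_energy \<mu> \<mu> \<le> 4 * mutual_energy ?\<rho> ?\<rho>"
    by (rule mult_left_mono) simp
  then have cross: "4 * mutual_energy \<mu> \<mu> \<le> 2 * mutual_energy \<mu> \<mu> + 2 * mutual_energy \<mu> \<nu>"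
    unfolding mutual_energy_fair_mixture[OF M(1) N(1) M(2) N(2)] same
    by (simp add: mult_2 mult_2_right ac_simps)
  have [measurable]: "(\<lambda>u. emeasure \<tau> {u<..u+1}) \<in> borel_measurable borel"
    if "prob_space \<tau>" and [measurable_cong]: "sets \<tau> = sets borel" for \<tau> :: "real measure"
  proof -
    interpret tau: prob_space \<tau> by fact
    have "emeasure \<tau> {u<..u+1} = (\<integral>\<^sup>+ x. indicator {u<..u+1} x \<partial>\<tau>)" for u
      by (rule nn_integral_indicator[symmetric]) (simp add: that(2))
    moreover have "(\<lambda>u. \<integral>\<^sup>+ x. indicator {u<..u+1} x \<partial>\<tau>) \<in> borel_measurable borel"
      unfolding greaterThanAtMost_iff indicator_def by measurable
    ultimately show ?thesis by simp
  qed
  note [measurable] = this[OF M(1,2)] this[OF N(1,2)]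
  let ?cross = "\<lambda>u. 2 * (emeasure \<mu> {u<..u+1} * emeasure \<nu> {u<..u+1})"
  let ?sum = "\<lambda>u. emeasure \<mu> {u<..u+1} * emeasure \<mu> {u<..u+1} +
      emeasure \<nu> {u<..u+1} * emeasure \<nu> {u<..u+1}"
  have A_cross: "2 * A \<mu> \<nu> = (\<integral>\<^sup>+ u. ?cross u \<partial>lborel)"
    unfolding A_def by (rule nn_integral_cmult[symmetric]) measurable
  have A_sum: "A \<mu> \<mu> + A \<nu> \<nu> = (\<integral>\<^sup>+ u. ?sum u \<partial>lborel)"
    unfolding A_def by (rule nn_integral_add[symmetric]) measurable
  have A_le: "2 * A \<mu> \<nu> \<le> A \<mu> \<mu> + A \<nu> \<nu>"
    unfolding A_cross A_sum by (intro nn_integral_mono ennreal_two_mult_le)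
  have B_le: "2 * B \<mu> \<nu> \<le> B \<mu> \<mu> + B \<nu> \<nu>"
  proof -
    have "2 * B \<mu> \<nu> = (\<integral>\<^sup>+ p. 2 * ((\<integral>\<^sup>+ x. scale_window p x \<partial>\<mu>) *
        (\<integral>\<^sup>+ x. scale_window p x \<partial>\<nu>)) \<partial>(lborel \<Otimes>\<^sub>M lborel))"
      unfolding B_def by (rule nn_integral_cmult[symmetric]) measurable
    also have "\<dots> \<le> (\<integral>\<^sup>+ p. (\<integral>\<^sup>+ x. scale_window p x \<partial>\<mu>) * (\<integral>\<^sup>+ x. scale_window p x \<partial>\<mu>) +
        (\<integral>\<^sup>+ x. scale_window p x \<partial>\<nu>) * (\<integral>\<^sup>+ x. scale_window p x \<partial>\<nu>) \<partial>(lborel \<Otimes>\<^sub>M lborel))"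
      by (intro nn_integral_mono ennreal_two_mult_le)
    also have "\<dots> = B \<mu> \<mu> + B \<nu> \<nu>"
      unfolding B_def by (rule nn_integral_add) measurable
    finally show ?thesis .
  qed
  \<comment> \<open>The scale part obeys \<open>2 f \<le> b + d\<close>; subtracting it is legitimate because all terms are finite.\<close>
  have arith: "a + c \<le> 2 * e"
    if "a + b = v" "c + d = v" "4 * v \<le> 2 * v + 2 * (e + f)" "2 * e \<le> a + c" "2 * f \<le> b + d" "v \<noteq> \<top>"
    for a b c d e f v :: ennreal
  proof -
    have fin: "a \<noteq> \<top>" "b \<noteq> \<top>" "c \<noteq> \<top>" "d \<noteq> \<top>"
      using that(1,2,6) by auto
    then have "e \<noteq> \<top>" "f \<noteq> \<top>"
      using that(4,5) by (auto simp: ennreal_mult_top top_unique)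
    have real_value: "\<exists>r \<ge> 0. x = ennreal r" if "x \<noteq> \<top>" for x
      using that by (cases x) auto
    obtain ra rb rc rd where
      "a = ennreal ra" "b = ennreal rb" "c = ennreal rc" "d = ennreal rd"
      "0 \<le> ra" "0 \<le> rb" "0 \<le> rc" "0 \<le> rd"
      using fin[THEN real_value] by blast
    moreover obtain re rf rv where "e = ennreal re" "f = ennreal rf" "v = ennreal rv"
      "0 \<le> re" "0 \<le> rf" "0 \<le> rv"
      using \<open>e \<noteq> \<top>\<close>[THEN real_value] \<open>f \<noteq> \<top>\<close>[THEN real_value] \<open>v \<noteq> \<top>\<close>[THEN real_value] by blast
    moreover note that(1-5)
    ultimately show ?thesis
      by (simp flip: ennreal_plus ennreal_mult ennreal_numeral)
  qed
  have "A \<mu> \<mu> + A \<nu> \<nu> \<le> 2 * A \<mu> \<nu>"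
    using split[OF mu mu] split[OF nu nu] split[OF mu nu] same cross A_le B_le V
    by (intro arith[of _ "B \<mu> \<mu>" "mutual_energy \<mu> \<mu>" _ "B \<nu> \<nu>" _ "B \<mu> \<nu>"]) auto
  moreover have "A \<mu> \<mu> + A \<nu> \<nu> \<noteq> \<top>"
  proof -
    have "A \<mu> \<mu> + B \<mu> \<mu> \<noteq> \<top>" "A \<nu> \<nu> + B \<nu> \<nu> \<noteq> \<top>"
      using V same by (simp_all flip: split[OF mu mu] split[OF nu nu])
    then show ?thesis by simp
  qed
  then have "2 * A \<mu> \<nu> \<noteq> \<infinity>"
    using A_le by (metis infinity_ennreal_def top_unique)
  ultimately have "AE u in lborel. ?sum u \<le> ?cross u"
    using nn_integral_less[of ?cross lborel ?sum] ennreal_two_mult_le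
    unfolding A_cross A_sum by fastforce
  then have "AE u in lborel. emeasure \<mu> {u<..u+1} = emeasure \<nu> {u<..u+1}"
  proof eventually_elim
    case (elim u)
    have "m = n" if "m * m + n * n \<le> 2 * (m * n)" for m n :: real
    proof -
      have "(m - n)\<^sup>2 \<le> 0" using that by (simp add: power2_eq_square algebra_simps)
      then show ?thesis by simp
    qed
    with elim show ?case
      by (simp add: mu.emeasure_eq_measure nu.emeasure_eq_measure
          flip: ennreal_mult ennreal_plus ennreal_numeral)
  qed
  with mu nu K show ?thesis by (rule eq_if_unit_windows_eq)
qed

section \<open>The level structure of the set and its flips\<close>

text \<open>The polynomial $T_s$ whose range on $K(\gamma)$ is centred at 0; it turns out to be $Q_{2^s}$.\<close>

definition centred_poly :: "(nat \<Rightarrow> real) \<Rightarrow> nat \<Rightarrow> real poly" where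
  "centred_poly \<gamma> s = PP \<gamma> s + [:rr \<gamma> s / 2:]"

definition square_shift :: "(nat \<Rightarrow> real) \<Rightarrow> nat \<Rightarrow> real" where
  "square_shift \<gamma> s = (rr \<gamma> s)\<^sup>2 / 4 - rr \<gamma> (Suc s) / 2"

lemma centred_poly_0: "centred_poly \<gamma> 0 = [:-1/2, 1:]"
  by (simp add: centred_poly_def)

lemma centred_poly_Suc:
  "centred_poly \<gamma> (Suc s) = [:- square_shift \<gamma> s, 0, 1:] \<circ>\<^sub>p centred_poly \<gamma> s"
  by (rule poly_ext)
    (simp add: centred_poly_def square_shift_def poly_pcompose power2_eq_square field_simps)

lemma poly_centred_poly_Suc:
  "poly (centred_poly \<gamma> (Suc s)) x = (poly (centred_poly \<gamma> s) x)\<^sup>2 - square_shift \<gamma> s"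
  unfolding centred_poly_Suc by (simp add: poly_pcompose power2_eq_square algebra_simps)

locale cantor_parameters =
  fixes \<gamma> :: "nat \<Rightarrow> real"
  assumes gamma: "s \<ge> 1 \<Longrightarrow> 0 < \<gamma> s \<and> \<gamma> s < 1/4"
begin

abbreviation "r \<equiv> rr \<gamma>"
abbreviation "c \<equiv> square_shift \<gamma>"
abbreviation "T s \<equiv> poly (centred_poly \<gamma> s)"
abbreviation "K \<equiv> K_set \<gamma>"

lemma r_pos: "r s > 0"
  using gamma by (induction s) auto

lemma r_Suc_less: "r (Suc s) < (r s)\<^sup>2 / 4"
  using gamma[of "Suc s"] r_pos[of s] by (auto intro: mult_strict_right_mono[of _ "1/4", simplified])

lemma r_le_1: "r s \<le> 1"
proof (induction s)
  case (Suc s)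
  have "(r s)\<^sup>2 \<le> 1" using Suc r_pos[of s] by (simp add: power_le_one)
  then show ?case using r_Suc_less[of s] by simp
qed simp

lemma mem_K_iff: "x \<in> K \<longleftrightarrow> (\<forall>s. \<bar>T s x\<bar> \<le> r s / 2)"
proof -
  have "poly (PP \<gamma> (Suc s)) x \<le> 0 \<longleftrightarrow> \<bar>T s x\<bar> \<le> r s / 2" for s
  proof -
    have "poly (PP \<gamma> (Suc s)) x = (T s x)\<^sup>2 - (r s / 2)\<^sup>2"
      by (simp add: centred_poly_def power2_eq_square field_simps)
    then show ?thesis
      using r_pos[of s] abs_le_square_iff[of "T s x" "r s / 2"] by simp
  qed
  then show ?thesis by (simp add: K_set_def E_level_def)
qed

lemma K_subset: "K \<subseteq> {0..1}"
proof
  fix x assume "x \<in> K"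
  then have "\<bar>T 0 x\<bar> \<le> r 0 / 2" unfolding mem_K_iff by blast
  then show "x \<in> {0..1}" by (simp add: centred_poly_0 abs_if split: if_splits)
qed

lemma T_bound: "x \<in> K \<Longrightarrow> \<bar>T s x\<bar> \<le> 1 / 2"
  using r_le_1[of s] by (auto simp: mem_K_iff intro: order_trans)

text \<open>Here $\gamma_{s+1} < 1/4$ enters: the critical value $-c_s$ of the map
$t \mapsto t^2 - c_s$ lies strictly below the interval in which $T_{s+1}$ takes its values on
$K(\gamma)$, so both branches of the inverse are defined there and do not meet.\<close>

lemma branch_point_separated:
  assumes "\<bar>w\<bar> \<le> r (Suc s) / 2"
  shows "0 < w + c s" "w + c s \<le> (r s / 2)\<^sup>2"
  using assms r_Suc_less[of s] by (auto simp: square_shift_def abs_le_iff power_divide)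

lemma T_nonzero: "x \<in> K \<Longrightarrow> T s x \<noteq> 0"
proof
  assume "x \<in> K" "T s x = 0"
  then have "0 < T (Suc s) x + c s"
    unfolding mem_K_iff by (intro branch_point_separated) blast
  then show False
    using \<open>T s x = 0\<close> by (simp add: poly_centred_poly_Suc)
qed

text \<open>With $s = i + n$, the function \<open>flip n i\<close> expresses, in the coordinate $T_i$, the self-map of
$K(\gamma)$ that reverses the sign of $T_s$ and keeps the signs of all $T_j$ with $j < s$: it
lifts $t \mapsto -t$ through the inverse branches of $t \mapsto t^2 - c_j$. The factor \<open>sgn t\<close>
makes every lift odd, which is what preserves symmetric laws at the lower levels.\<close>

primrec flip :: "nat \<Rightarrow> nat \<Rightarrow> real \<Rightarrow> real" where
  "flip 0 i t = - t"
| "flip (Suc n) i t = sgn t * sqrt (flip n (Suc i) (t\<^sup>2 - c i) + c i)"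

lemma flip_odd: "flip n i (- t) = - flip n i t"
  by (cases n) (simp_all add: sgn_minus)

lemma flip_measurable [measurable]: "flip n i \<in> borel_measurable borel"
proof (induction n arbitrary: i)
  case (Suc n)
  note [measurable] = Suc
  show ?case by simp
next
  case 0
  have "flip 0 i = (\<lambda>t. - t)" by (rule ext) simp
  then show ?case by simp
qed

lemma flip_bound: "x \<in> K \<Longrightarrow> \<bar>flip n i (T i x)\<bar> \<le> r i / 2"
proof (induction n arbitrary: i)
  case 0
  then show ?case by (simp add: mem_K_iff)
next
  case (Suc n)
  let ?w = "flip n (Suc i) (T (Suc i) x)"
  have "sqrt (?w + c i) \<le> r i / 2"
    using branch_point_separated[OF Suc.IH[OF Suc.prems]] r_pos[of i] by (intro real_le_lsqrt) auto
  then show ?case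
    using branch_point_separated(1)[OF Suc.IH[OF Suc.prems], of i] T_nonzero[OF Suc.prems, of i]
    by (simp add: abs_mult abs_sgn_eq flip: poly_centred_poly_Suc)
qed

lemma flip_Suc_square:
  assumes "x \<in> K"
  shows "(flip (Suc n) i (T i x))\<^sup>2 - c i = flip n (Suc i) (T (Suc i) x)"
  using branch_point_separated(1)[OF flip_bound[OF assms], of n i] T_nonzero[OF assms, of i]
  by (simp add: power_mult_distrib sgn_if flip: poly_centred_poly_Suc)

definition level_flip :: "nat \<Rightarrow> real \<Rightarrow> real" where
  "level_flip s x = flip s 0 (x - 1 / 2) + 1 / 2"

lemma level_flip_measurable [measurable]: "level_flip s \<in> borel_measurable borel"
  unfolding level_flip_def by measurable

lemma T_level_flip_below:
  assumes "x \<in> K" "i \<le> s"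
  shows "T i (level_flip s x) = flip (s - i) i (T i x)"
  using assms(2)
proof (induction i)
  case 0
  then show ?case by (simp add: level_flip_def centred_poly_0 algebra_simps)
next
  case (Suc i)
  then have "s - i = Suc (s - Suc i)" by simp
  with Suc show ?case
    using flip_Suc_square[OF assms(1), of "s - Suc i" i] by (simp only: poly_centred_poly_Suc[of _ i])
qed

lemma T_level_flip: "x \<in> K \<Longrightarrow> T s (level_flip s x) = - T s x"
  using T_level_flip_below[of x s s] by simp

lemma T_level_flip_above:
  assumes "x \<in> K" "s < i"
  shows "T i (level_flip s x) = T i x"
proof -
  have "T (Suc (s + n)) (level_flip s x) = T (Suc (s + n)) x" for n
    by (induction n) (simp_all add: poly_centred_poly_Suc T_level_flip[OF assms(1)])
  from this[of "i - Suc s"] assms(2) show ?thesis by simp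
qed

lemma level_flip_in_K:
  assumes "x \<in> K"
  shows "level_flip s x \<in> K"
  unfolding mem_K_iff
proof
  fix i
  show "\<bar>T i (level_flip s x)\<bar> \<le> r i / 2"
  proof (cases "i \<le> s")
    case True
    then show ?thesis
      unfolding T_level_flip_below[OF assms True] by (intro flip_bound assms)
  next
    case False
    then show ?thesis using assms by (simp add: T_level_flip_above mem_K_iff)
  qed
qed

end

text \<open>Equality of the laws of \<open>g\<close> and \<open>- g\<close>, in the form in which nonnegative integrals use it.\<close>

definition symmetric_law :: "real measure \<Rightarrow> (real \<Rightarrow> real) \<Rightarrow> bool" where
  "symmetric_law \<mu> g \<longleftrightarrow> (\<forall>h \<in> borel_measurable borel.
     (\<integral>\<^sup>+ x. h (g x) \<partial>\<mu>) = (\<integral>\<^sup>+ x. h (- g x) \<partial>\<mu>))"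

lemma symmetric_lawD:
  "symmetric_law \<mu> g \<Longrightarrow> h \<in> borel_measurable borel \<Longrightarrow>
    (\<integral>\<^sup>+ x. h (g x) \<partial>\<mu>) = (\<integral>\<^sup>+ x. h (- g x) \<partial>\<mu>)"
  by (simp add: symmetric_law_def)

lemma symmetric_law_imp_integral:
  fixes f :: "real \<Rightarrow> real"
  assumes "symmetric_law \<mu> g" and [measurable]: "g \<in> borel_measurable \<mu>" "f \<in> borel_measurable borel"
  shows "(LINT x|\<mu>. f (- g x)) = (LINT x|\<mu>. f (g x))"
proof -
  have "distr \<mu> borel g = distr \<mu> borel (\<lambda>x. - g x)"
  proof (rule measure_eqI)
    fix A assume "A \<in> sets (distr \<mu> borel g)"
    then have [measurable]: "A \<in> sets borel" by simp
    have "(\<integral>\<^sup>+ x. indicator A (g x) \<partial>\<mu>) = (\<integral>\<^sup>+ x. indicator A (- g x) \<partial>\<mu>)"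
      by (rule symmetric_lawD[OF assms(1)]) measurable
    moreover have "emeasure (distr \<mu> borel k) A = (\<integral>\<^sup>+ x. indicator A (k x) \<partial>\<mu>)"
      if [measurable]: "k \<in> borel_measurable \<mu>" for k
      using nn_integral_distr[of k \<mu> borel "indicator A"] by simp
    ultimately show "emeasure (distr \<mu> borel g) A = emeasure (distr \<mu> borel (\<lambda>x. - g x)) A"
      by simp
  qed simp
  then have "(LINT y|distr \<mu> borel (\<lambda>x. - g x). f y) = (LINT y|distr \<mu> borel g. f y)"
    by simp
  then show ?thesis
    by (simp add: integral_distr)
qed

text \<open>The bound $1/2$ ensures that both logarithms on the left are nonnegative, so that no truncation
occurs in \<open>ennreal\<close>.\<close>

lemma lk_square:
  assumes "\<bar>a\<bar> \<le> 1/2" "\<bar>b\<bar> \<le> 1/2"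
  shows "lk a b + lk a (- b) = lk (a\<^sup>2 - c) (b\<^sup>2 - c)"
proof (cases "a = b \<or> a = - b")
  case True
  then show ?thesis by (auto simp: lk_eq)
next
  case False
  have eq: "a\<^sup>2 - b\<^sup>2 = (a - b) * (a + b)"
    by (simp add: power2_eq_square algebra_simps)
  have nz: "a - b \<noteq> 0" "a + b \<noteq> 0" using False by auto
  have "\<bar>a - b\<bar> \<le> 1" "\<bar>a + b\<bar> \<le> 1" using assms by (auto simp: abs_le_iff)
  then have "ln \<bar>a - b\<bar> \<le> 0" "ln \<bar>a + b\<bar> \<le> 0" using nz by auto
  moreover have "ln \<bar>a\<^sup>2 - b\<^sup>2\<bar> = ln \<bar>a - b\<bar> + ln \<bar>a + b\<bar>"
    unfolding eq abs_mult using nz by (intro ln_mult_pos) auto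
  moreover have "a\<^sup>2 \<noteq> b\<^sup>2" using False by (auto simp: power2_eq_iff)
  ultimately show ?thesis
    using False by (simp add: lk_eq flip: ennreal_plus)
qed

lemma lk_minus: "lk (- a) (- b) = lk a b"
  by (simp add: lk_eq abs_minus_commute)

context cantor_parameters
begin

lemma T_measurable [measurable]: "T s \<in> borel_measurable borel"
  by (intro borel_measurable_continuous_onI continuous_intros)

text \<open>The logarithmic energy of the law of $T_s$.\<close>

definition level_energy :: "nat \<Rightarrow> real measure \<Rightarrow> ennreal" where
  "level_energy s \<mu> = (\<integral>\<^sup>+ x. \<integral>\<^sup>+ y. lk (T s x) (T s y) \<partial>\<mu> \<partial>\<mu>)"

lemma level_energy_0: "level_energy 0 \<mu> = mutual_energy \<mu> \<mu>"
proof -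
  have "lk (T 0 x) (T 0 y) = lk x y" for x y
    by (simp add: centred_poly_0 lk_eq)
  then show ?thesis by (simp add: level_energy_def mutual_energy_def)
qed

text \<open>Symmetry allows $T_s(y)$ to be replaced by $-T_s(y)$ in the inner integral; adding both versions
gives the kernel at $T_{s+1}$ by \<open>lk_square\<close>.\<close>

lemma level_energy_Suc:
  assumes mu: "\<mu> \<in> prob_measures_on K" and sym: "symmetric_law \<mu> (T s)"
  shows "level_energy (Suc s) \<mu> = 2 * level_energy s \<mu>"
proof -
  note M = prob_measures_onD[OF mu]
  interpret prob_space \<mu> by fact
  note [measurable_cong] = M(2)
  have reflected: "(\<integral>\<^sup>+ y. lk (T s x) (T s y) \<partial>\<mu>) = (\<integral>\<^sup>+ y. lk (T s x) (- T s y) \<partial>\<mu>)" for x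
    by (rule symmetric_lawD[OF sym]) measurable
  have "level_energy (Suc s) \<mu> = (\<integral>\<^sup>+ x. \<integral>\<^sup>+ y. lk (T s x) (T s y) + lk (T s x) (- T s y) \<partial>\<mu> \<partial>\<mu>)"
    unfolding level_energy_def poly_centred_poly_Suc
    by (rule nn_integral_cong_on_carrier[OF M(4) M(4)])
      (rule lk_square[symmetric]; intro T_bound)
  also have "\<dots> = (\<integral>\<^sup>+ x. (\<integral>\<^sup>+ y. lk (T s x) (T s y) \<partial>\<mu>) + (\<integral>\<^sup>+ y. lk (T s x) (- T s y) \<partial>\<mu>) \<partial>\<mu>)"
    by (intro nn_integral_cong nn_integral_add) measurable
  also have "\<dots> = (\<integral>\<^sup>+ x. 2 * (\<integral>\<^sup>+ y. lk (T s x) (T s y) \<partial>\<mu>) \<partial>\<mu>)"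
    by (simp add: reflected mult_2)
  also have "\<dots> = 2 * level_energy s \<mu>"
    unfolding level_energy_def by (rule nn_integral_cmult) measurable
  finally show ?thesis .
qed

lemma level_energy_eq:
  assumes "\<mu> \<in> prob_measures_on K" "\<And>i. i < s \<Longrightarrow> symmetric_law \<mu> (T i)"
  shows "level_energy s \<mu> = 2 ^ s * mutual_energy \<mu> \<mu>"
  using assms(2)
proof (induction s)
  case (Suc s)
  then show ?case
    using level_energy_Suc[OF assms(1), of s] by (simp add: mult.assoc)
qed (simp add: level_energy_0)

text \<open>The push-forward under the flip at level \<open>s\<close> is an admissible competitor: it lives on
$K(\gamma)$, inherits the symmetries already known, and has the same energy at level \<open>s\<close>
because the kernel is invariant under a simultaneous change of sign.\<close>

lemma level_flip_law:
  assumes mu: "\<mu> \<in> prob_measures_on K"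
  shows "distr \<mu> borel (level_flip s) \<in> prob_measures_on K"
    and "i \<le> s \<Longrightarrow> symmetric_law \<mu> (T i) \<Longrightarrow> symmetric_law (distr \<mu> borel (level_flip s)) (T i)"
    and "level_energy s (distr \<mu> borel (level_flip s)) = level_energy s \<mu>"
proof -
  note M = prob_measures_onD[OF mu]
  interpret prob_space \<mu> by fact
  note [measurable_cong] = M(2)
  have [measurable]: "level_flip s \<in> borel_measurable \<mu>" by measurable
  let ?\<nu> = "distr \<mu> borel (level_flip s)"
  show "?\<nu> \<in> prob_measures_on K"
  proof (rule prob_measures_onI)
    show "prob_space ?\<nu>" by (rule prob_space_distr) measurable
    show "AE x in ?\<nu>. x \<in> K"
      using M(3,4) by (subst AE_distr_iff) (auto simp: level_flip_in_K elim!: eventually_mono)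
  qed (use M(3) in auto)
  show "symmetric_law ?\<nu> (T i)" if "i \<le> s" and sym: "symmetric_law \<mu> (T i)"
    unfolding symmetric_law_def
  proof
    fix h :: "real \<Rightarrow> ennreal" assume [measurable]: "h \<in> borel_measurable borel"
    let ?f = "flip (s - i) i"
    have push: "(\<integral>\<^sup>+ x. g (T i x) \<partial>?\<nu>) = (\<integral>\<^sup>+ x. g (?f (T i x)) \<partial>\<mu>)"
      if [measurable]: "g \<in> borel_measurable borel" for g :: "real \<Rightarrow> ennreal"
    proof -
      have "(\<integral>\<^sup>+ x. g (T i x) \<partial>?\<nu>) = (\<integral>\<^sup>+ x. g (T i (level_flip s x)) \<partial>\<mu>)"
        by (rule nn_integral_distr) measurable
      also have "\<dots> = (\<integral>\<^sup>+ x. g (?f (T i x)) \<partial>\<mu>)"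
        by (intro nn_integral_cong_AE)
          (use M(4) \<open>i \<le> s\<close> in \<open>auto simp: T_level_flip_below elim!: eventually_mono\<close>)
      finally show ?thesis .
    qed
    have "(\<integral>\<^sup>+ x. h (T i x) \<partial>?\<nu>) = (\<integral>\<^sup>+ x. h (?f (T i x)) \<partial>\<mu>)"
      by (rule push) measurable
    also have "\<dots> = (\<integral>\<^sup>+ x. h (?f (- T i x)) \<partial>\<mu>)"
      by (rule symmetric_lawD[OF sym]) measurable
    also have "\<dots> = (\<integral>\<^sup>+ x. h (- T i x) \<partial>?\<nu>)"
      unfolding flip_odd by (rule push[symmetric]) measurable
    finally show "(\<integral>\<^sup>+ x. h (T i x) \<partial>?\<nu>) = (\<integral>\<^sup>+ x. h (- T i x) \<partial>?\<nu>)" .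
  qed
  have "level_energy s ?\<nu> = (\<integral>\<^sup>+ x. \<integral>\<^sup>+ y. lk (T s x) (T s (level_flip s y)) \<partial>\<mu> \<partial>?\<nu>)"
    unfolding level_energy_def by (intro nn_integral_cong nn_integral_distr) measurable
  also have "\<dots> = (\<integral>\<^sup>+ x. \<integral>\<^sup>+ y. lk (T s (level_flip s x)) (T s (level_flip s y)) \<partial>\<mu> \<partial>\<mu>)"
    by (rule nn_integral_distr) measurable
  also have "\<dots> = level_energy s \<mu>"
    unfolding level_energy_def
    by (rule nn_integral_cong_on_carrier[OF M(4) M(4)]) (simp add: T_level_flip lk_minus)
  finally show "level_energy s ?\<nu> = level_energy s \<mu>" .
qed

end

locale equilibrium = cantor_parameters +
  fixes \<mu> :: "real measure"
  assumes equilibrium: "is_equilibrium_measure K \<mu>"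
    and finite_energy: "min_energy K \<noteq> \<infinity>"
begin

lemma mu_on_K: "\<mu> \<in> prob_measures_on K"
  using equilibrium by (simp add: is_equilibrium_measure_def)

sublocale prob_space \<mu>
  using prob_measures_onD(1)[OF mu_on_K] .

lemma sets_mu [simp, measurable_cong]: "sets \<mu> = sets borel"
  using prob_measures_onD(2)[OF mu_on_K] .

lemma AE_in_K: "AE x in \<mu>. x \<in> K"
  using prob_measures_onD(4)[OF mu_on_K] .

text \<open>The symmetries at the levels below \<open>s\<close> transport equality of the level-\<open>s\<close> energies of \<open>\<mu>\<close> and
its flip back to equality of the true energies; then the flip fixes \<open>\<mu>\<close> by uniqueness.\<close>

theorem equilibrium_symmetric: "symmetric_law \<mu> (T s)"
proof (induction s rule: less_induct)
  case (less s)
  let ?\<nu> = "distr \<mu> borel (level_flip s)"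
  note flipped = level_flip_law[OF mu_on_K, where s = s]
  have "2 ^ s * mutual_energy ?\<nu> ?\<nu> = level_energy s ?\<nu>"
    using less by (intro level_energy_eq[OF flipped(1), symmetric] flipped(2)) auto
  also have "\<dots> = 2 ^ s * mutual_energy \<mu> \<mu>"
    using less by (simp add: flipped(3) level_energy_eq[OF mu_on_K])
  finally have "mutual_energy ?\<nu> ?\<nu> = mutual_energy \<mu> \<mu>"
    by (subst (asm) ennreal_mult_cancel_left) (auto simp: power_eq_top_ennreal)
  then have "\<mu> = ?\<nu>"
    using equilibrium finite_energy
    by (intro energy_minimizer_unique[OF mu_on_K flipped(1) K_subset])
      (auto simp: is_equilibrium_measure_def)
  show ?case
    unfolding symmetric_law_def
  proof
    fix h :: "real \<Rightarrow> ennreal" assume [measurable]: "h \<in> borel_measurable borel"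
    have "(\<integral>\<^sup>+ x. h (T s x) \<partial>\<mu>) = (\<integral>\<^sup>+ x. h (T s x) \<partial>?\<nu>)"
      using \<open>\<mu> = ?\<nu>\<close> by simp
    also have "\<dots> = (\<integral>\<^sup>+ x. h (T s (level_flip s x)) \<partial>\<mu>)"
      by (rule nn_integral_distr) measurable
    also have "\<dots> = (\<integral>\<^sup>+ x. h (- T s x) \<partial>\<mu>)"
      by (intro nn_integral_cong_AE)
        (use AE_in_K in \<open>auto simp: T_level_flip elim!: eventually_mono\<close>)
    finally show "(\<integral>\<^sup>+ x. h (T s x) \<partial>\<mu>) = (\<integral>\<^sup>+ x. h (- T s x) \<partial>\<mu>)" .
  qed
qed

end

section \<open>Orthogonal polynomials of the equilibrium measure\<close>

context equilibrium
begin

lemma poly_integrable: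
  fixes p :: "real poly"
  shows "integrable \<mu> (poly p)"
proof -
  have "compact (poly p ` {0..1})"
    by (intro compact_continuous_image continuous_intros) auto
  then obtain B where B: "\<And>x. x \<in> {0..1} \<Longrightarrow> norm (poly p x) \<le> B"
    by (meson compact_imp_bounded bounded_iff imageI)
  have [measurable]: "poly p \<in> borel_measurable borel"
    by (intro borel_measurable_continuous_onI continuous_intros)
  have "AE x in \<mu>. norm (poly p x) \<le> B"
    using AE_in_K by eventually_elim (use B K_subset in blast)
  then show ?thesis
    by (rule integrable_const_bound) measurable
qed

definition moment :: "real poly \<Rightarrow> real" where
  "moment p = (LINT x|\<mu>. poly p x)"

lemma moment_add: "moment (p + q) = moment p + moment q"
  by (simp add: moment_def poly_integrable)

lemma moment_smult: "moment (smult a p) = a * moment p"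
  by (simp add: moment_def)

lemma moment_diff: "moment (p - q) = moment p - moment q"
  by (simp add: moment_def poly_integrable)

definition level_moment :: "nat \<Rightarrow> real poly \<Rightarrow> real" where
  "level_moment s p = moment (p \<circ>\<^sub>p centred_poly \<gamma> s)"

lemma level_moment_Suc: "level_moment (Suc s) p = level_moment s (p \<circ>\<^sub>p [:- c s, 0, 1:])"
  by (simp add: level_moment_def centred_poly_Suc pcompose_assoc)

lemma level_moment_symmetric: "level_moment s (p \<circ>\<^sub>p [:0, -1:]) = level_moment s p"
proof -
  have [measurable]: "poly p \<in> borel_measurable borel"
    by (intro borel_measurable_continuous_onI continuous_intros)
  have "(LINT x|\<mu>. poly p (- T s x)) = (LINT x|\<mu>. poly p (T s x))"
    by (rule symmetric_law_imp_integral[OF equilibrium_symmetric]) measurable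
  then show ?thesis
    by (simp add: level_moment_def moment_def poly_pcompose)
qed

end

locale equilibrium_polys = equilibrium +
  fixes Q :: "nat \<Rightarrow> real poly" and a b :: "nat \<Rightarrow> real"
  assumes orth: "monic_orthogonal_polys \<mu> Q"
    and coeffs: "recurrence_coeffs Q a b"
begin

definition h :: "nat \<Rightarrow> real" where
  "h n = moment (Q n * Q n)"

lemma Q_degree: "degree (Q n) = n"
  and Q_monic: "lead_coeff (Q n) = 1"
  using orth unfolding monic_orthogonal_polys_def by blast+

lemma Q_orthogonal: "m \<noteq> n \<Longrightarrow> moment (Q m * Q n) = 0"
  using orth by (simp add: monic_orthogonal_polys_def moment_def)

lemma a_pos: "n \<ge> 1 \<Longrightarrow> a n > 0"
  using coeffs by (simp add: recurrence_coeffs_def)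

lemma Q_recurrence:
  "Q (Suc n) = [:- b (Suc n), 1:] * Q n - smult ((a n)\<^sup>2) (if n = 0 then 0 else Q (n - 1))"
  using coeffs unfolding recurrence_coeffs_def by blast

lemma Q_0: "Q 0 = 1"
proof -
  obtain d where d: "Q 0 = [:d:]"
    using Q_degree[of 0] by (rule degree_eq_zeroE)
  then show ?thesis
    using Q_monic[of 0] by (simp add: one_pCons)
qed

lemma h_0: "h 0 = 1"
  by (simp add: h_def moment_def Q_0 prob_space)

text \<open>Both sides equal $\int x\,Q_n Q_{n+1}\,d\mu$: test the recurrence for $Q_{n+1}$ with $Q_{n+1}$,
and the recurrence for $Q_{n+2}$ with $Q_n$. Since \<open>a\<close> is positive, this also shows that no
squared norm vanishes.\<close>

lemma h_Suc: "h (Suc n) = (a (Suc n))\<^sup>2 * h n"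
proof -
  have shift: "moment ([:d, 1:] * p) = moment ([:0, 1:] * p)" if "moment p = 0" for d p
    using that by (simp add: moment_add moment_smult)
  have "moment (Q (Suc n) * Q (Suc n)) =
      moment ([:- b (Suc n), 1:] * (Q n * Q (Suc n)))
      - (a n)\<^sup>2 * moment ((if n = 0 then 0 else Q (n - 1)) * Q (Suc n))"
    by (subst (1) Q_recurrence) (simp only: left_diff_distrib mult_smult_left moment_diff moment_smult mult.assoc)
  also have "\<dots> = moment ([:0, 1:] * (Q n * Q (Suc n)))"
  proof -
    have "moment ((if n = 0 then 0 else Q (n - 1)) * Q (Suc n)) = 0"
      using Q_orthogonal[of "n - 1" "Suc n"] by (cases n) (simp_all add: moment_def)
    moreover have "moment ([:- b (Suc n), 1:] * (Q n * Q (Suc n))) = moment ([:0, 1:] * (Q n * Q (Suc n)))"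
      by (intro shift Q_orthogonal) simp
    ultimately show ?thesis by (simp only: mult_zero_right diff_zero)
  qed
  finally have up: "h (Suc n) = moment ([:0, 1:] * (Q n * Q (Suc n)))"
    by (simp only: h_def)
  have "moment (Q (Suc (Suc n)) * Q n) =
      moment ([:- b (Suc (Suc n)), 1:] * (Q (Suc n) * Q n)) - (a (Suc n))\<^sup>2 * h n"
    by (subst (1) Q_recurrence)
      (simp only: left_diff_distrib mult_smult_left moment_diff moment_smult mult.assoc h_def
        nat.distinct if_False diff_Suc_1)
  moreover have "moment ([:- b (Suc (Suc n)), 1:] * (Q (Suc n) * Q n)) = moment ([:0, 1:] * (Q (Suc n) * Q n))"
    by (intro shift Q_orthogonal) simp
  moreover have "moment (Q (Suc (Suc n)) * Q n) = 0"
    by (rule Q_orthogonal) simp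
  ultimately have "moment ([:0, 1:] * (Q (Suc n) * Q n)) = (a (Suc n))\<^sup>2 * h n"
    by linarith
  with up show ?thesis by (simp only: mult.commute[of "Q n"])
qed

lemma h_pos: "h n > 0"
proof (induction n)
  case (Suc n)
  then show ?case using a_pos[of "Suc n"] by (simp add: h_Suc)
qed (simp add: h_0)

lemma prod_a_squared: "m \<le> n \<Longrightarrow> (\<Prod>j = m + 1..n. (a j)\<^sup>2) = h n / h m"
proof (induction n rule: dec_induct)
  case base
  then show ?case using h_pos[of m] by simp
next
  case (step n)
  then show ?case by (simp add: h_Suc mult.commute)
qed

lemma level_symmetric_orthogonal:
  "orthogonal_sequence (level_moment s) q \<Longrightarrow> symmetric_orthogonal_sequence (level_moment s) q"
  by (intro symmetric_orthogonal_sequence.intro symmetric_orthogonal_sequence_axioms.intro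
      level_moment_symmetric)

text \<open>Level by level: \<open>even_subsequence\<close> halves the degrees, and $T_{s+1}$ is the image of $T_s$ under
the quadratic map, so the even-degree polynomials at level \<open>s\<close> are the polynomials at level
\<open>s + 1\<close>.\<close>

lemma level_sequence:
  "\<exists>q. symmetric_orthogonal_sequence (level_moment s) q \<and>
     (\<forall>m. Q (2 ^ s * m) = q m \<circ>\<^sub>p centred_poly \<gamma> s)"
proof (induction s)
  case 0
  let ?q = "\<lambda>m. Q m \<circ>\<^sub>p [:1/2, 1:]"
  have cancel: "(p \<circ>\<^sub>p [:1/2, 1:]) \<circ>\<^sub>p centred_poly \<gamma> 0 = p" for p
    by (simp add: centred_poly_0 pcompose_pCons flip: pcompose_assoc)
  have "orthogonal_sequence (level_moment 0) ?q"
  proof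
    show "degree (?q n) = n" for n
      by (simp add: degree_pcompose Q_degree)
    show "lead_coeff (?q n) = 1" for n
      using Q_monic[of n] by (subst lead_coeff_comp) auto
  qed (use Q_orthogonal h_pos in
      \<open>auto simp: level_moment_def cancel pcompose_mult pcompose_add pcompose_smult
        moment_add moment_smult h_def\<close>)
  then have "symmetric_orthogonal_sequence (level_moment 0) ?q"
    by (rule level_symmetric_orthogonal)
  with cancel show ?case by (intro exI[of _ ?q]) auto
next
  case (Suc s)
  then obtain q where "symmetric_orthogonal_sequence (level_moment s) q"
    and q: "\<And>m. Q (2 ^ s * m) = q m \<circ>\<^sub>p centred_poly \<gamma> s" by blast
  then interpret symmetric_orthogonal_sequence "level_moment s" q by blast
  obtain r where r: "\<And>k. q (2 * k) = r k \<circ>\<^sub>p [:- c s, 0, 1:]"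
    and "orthogonal_sequence (\<lambda>p. level_moment s (p \<circ>\<^sub>p [:- c s, 0, 1:])) r"
    using even_subsequence by blast
  then have "symmetric_orthogonal_sequence (level_moment (Suc s)) r"
    by (intro level_symmetric_orthogonal) (simp add: level_moment_Suc[abs_def])
  moreover have "Q (2 ^ Suc s * k) = r k \<circ>\<^sub>p centred_poly \<gamma> (Suc s)" for k
    using q[of "2 * k"] r[of k] by (simp add: centred_poly_Suc pcompose_assoc mult_ac)
  ultimately show ?case by blast
qed

lemma Q_power_of_2: "Q (2 ^ s) = centred_poly \<gamma> s"
proof -
  obtain q where "symmetric_orthogonal_sequence (level_moment s) q"
    and q: "\<And>m. Q (2 ^ s * m) = q m \<circ>\<^sub>p centred_poly \<gamma> s"
    using level_sequence[of s] by blast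
  then show ?thesis
    using symmetric_orthogonal_sequence.q_1[of "level_moment s" q] q[of 1]
    by (simp add: pcompose_pCons)
qed

text \<open>$T_s^2 = T_{s+1} + c_s$, and $T_{s+1}$ averages to 0 against $Q_{2^{s+1}k}^2$, which is an even
function of $T_{s+1}$.\<close>

lemma second_moment_of_level:
  "moment (centred_poly \<gamma> s * centred_poly \<gamma> s * (Q (2 ^ Suc s * k) * Q (2 ^ Suc s * k))) =
     c s * h (2 ^ Suc s * k)"
proof -
  let ?f = "Q (2 ^ Suc s * k) * Q (2 ^ Suc s * k)"
  obtain q where sym: "symmetric_orthogonal_sequence (level_moment (Suc s)) q"
    and q: "\<And>m. Q (2 ^ Suc s * m) = q m \<circ>\<^sub>p centred_poly \<gamma> (Suc s)"
    using level_sequence[of "Suc s"] by blast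
  have "centred_poly \<gamma> s * centred_poly \<gamma> s = centred_poly \<gamma> (Suc s) + [:c s:]"
    by (rule poly_ext) (simp add: poly_centred_poly_Suc power2_eq_square)
  then have "moment (centred_poly \<gamma> s * centred_poly \<gamma> s * ?f) =
      moment (centred_poly \<gamma> (Suc s) * ?f) + c s * moment ?f"
    by (simp add: distrib_right moment_add moment_smult)
  also have "centred_poly \<gamma> (Suc s) * ?f = ([:0, 1:] * (q k * q k)) \<circ>\<^sub>p centred_poly \<gamma> (Suc s)"
    unfolding q pcompose_mult by (simp add: pcompose_pCons)
  also have "moment \<dots> = 0"
    using symmetric_orthogonal_sequence.mean_zero[OF sym, of k] by (simp only: level_moment_def)
  finally show ?thesis by (simp only: h_def add_0_left)
qed

lemma h_power_of_2: "h (2 ^ s) = c s"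
  using second_moment_of_level[of s 0] by (simp add: h_0 Q_0) (simp add: h_def Q_power_of_2)

text \<open>The integral of $T_s^2 Q_{2^{s+1}k}^2$ computed in two ways: by \<open>second_moment_of_level\<close>, and as
the squared norm of $T_s Q_{2^{s+1}k}$, whose two orthogonal components are given by the
three-term relation at level \<open>s\<close>.\<close>

lemma ratio_identity:
  assumes "k \<ge> 1"
  shows "h (2 ^ s * (2 * k + 1)) / h (2 ^ (s + 1) * k) +
    h (2 ^ (s + 1) * k) / h (2 ^ (s + 1) * k - 2 ^ s) = h (2 ^ s)"
proof -
  obtain q where sym: "symmetric_orthogonal_sequence (level_moment s) q"
    and q: "\<And>m. Q (2 ^ s * m) = q m \<circ>\<^sub>p centred_poly \<gamma> s"
    using level_sequence[of s] by blast
  have norms: "level_moment s (q m * q m) = h (2 ^ s * m)" for m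
    by (simp add: level_moment_def h_def q pcompose_mult)
  \<comment> \<open>At level \<open>s\<close> the polynomial $Q_{2^{s+1}k}$ has degree \<open>2 k = Suc n\<close> in $T_s$.\<close>
  define n where "n = 2 * k - 1"
  have n: "Suc n = 2 * k" "Suc (Suc n) = 2 * k + 1"
    and indices: "2 ^ s * Suc n = 2 ^ (s + 1) * k" "2 ^ s * n = 2 ^ (s + 1) * k - 2 ^ s"
    using assms by (auto simp: n_def algebra_simps)
  have "c s * h (2 ^ (s + 1) * k) = level_moment s ([:0, 0, 1:] * (q (Suc n) * q (Suc n)))"
  proof -
    have "([:0, 0, 1:] * (q (Suc n) * q (Suc n))) \<circ>\<^sub>p centred_poly \<gamma> s =
        centred_poly \<gamma> s * centred_poly \<gamma> s * (Q (2 ^ s * Suc n) * Q (2 ^ s * Suc n))"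
      unfolding q pcompose_mult by (simp add: pcompose_pCons)
    then show ?thesis
      using second_moment_of_level[of s k] indices(1) by (simp add: level_moment_def)
  qed
  also have "\<dots> = h (2 ^ s * (2 * k + 1)) + (h (2 ^ (s + 1) * k))\<^sup>2 / h (2 ^ (s + 1) * k - 2 ^ s)"
    unfolding symmetric_orthogonal_sequence.norm_times_variable[OF sym] norms indices n(2) ..
  finally show ?thesis
    using h_pos[of "2 ^ (s + 1) * k"] h_pos[of "2 ^ (s + 1) * k - 2 ^ s"]
    by (simp add: h_power_of_2 field_simps power2_eq_square)
qed

lemma square_shift_eq: "c s = (1 - 2 * \<gamma> (s + 1)) * (r s)\<^sup>2 / 4"
  by (simp add: square_shift_def field_simps)

lemma L2_norm_squared: "(L2_norm \<mu> (poly (Q n)))\<^sup>2 = h n"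
  and integral_square: "(LINT x|\<mu>. (poly (Q n) x)\<^sup>2) = h n"
proof -
  show "(LINT x|\<mu>. (poly (Q n) x)\<^sup>2) = h n"
    by (simp add: h_def moment_def power2_eq_square)
  then show "(L2_norm \<mu> (poly (Q n)))\<^sup>2 = h n"
    using h_pos[of n] by (simp add: L2_norm_def)
qed

lemma sum_identity:
  assumes "k \<ge> 1"
  shows "(\<Prod>j = 2^(s+1)*k + 1 .. 2^s*(2*k+1). (a j)\<^sup>2)
      + (\<Prod>j = 2^(s+1)*k - 2^s + 1 .. 2^(s+1)*k. (a j)\<^sup>2) = h (2 ^ s)"
proof -
  have "2^(s+1)*k \<le> 2^s*(2*k+1)" by (simp add: algebra_simps)
  then show ?thesis
    using ratio_identity[OF assms, of s] by (simp only: prod_a_squared diff_le_self)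
qed

lemma prod_a_eq_norm: "(\<Prod>j = 1..n. a j)\<^sup>2 = h n"
  using prod_a_squared[of 0 n] by (simp add: h_0 prod_power_distrib)

lemma coeff_system_a: "coeff_system \<gamma> N a"
  unfolding coeff_system_def
  by (intro conjI allI impI)
    (simp_all only: sum_identity prod_a_eq_norm h_power_of_2 square_shift_eq)

end

lemma coeff_system_cong:
  assumes "\<And>n. 1 \<le> n \<Longrightarrow> n \<le> N \<Longrightarrow> c n = d n"
  shows "coeff_system \<gamma> N c \<longleftrightarrow> coeff_system \<gamma> N d"
proof -
  have 1: "(\<Prod>j = 2^(s+1)*k + 1 .. 2^s*(2*k+1). (c j)\<^sup>2) = (\<Prod>j = 2^(s+1)*k + 1 .. 2^s*(2*k+1). (d j)\<^sup>2)"
    and 2: "(\<Prod>j = 2^(s+1)*k - 2^s + 1 .. 2^(s+1)*k. (c j)\<^sup>2) = (\<Prod>j = 2^(s+1)*k - 2^s + 1 .. 2^(s+1)*k. (d j)\<^sup>2)"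
    if "2 ^ s * (2 * k + 1) \<le> N" for s k
    using that by (auto intro!: prod.cong simp: assms algebra_simps)
  have 3: "(\<Prod>j = 1 .. 2^s. c j) = (\<Prod>j = 1 .. 2^s. d j)" if "2 ^ s \<le> N" for s
    using that by (intro prod.cong) (auto simp: assms)
  show ?thesis
    unfolding coeff_system_def using 1 2 3 by simp
qed

lemma prod_top_cancel:
  fixes f g :: "nat \<Rightarrow> real"
  assumes "m < n" "\<And>j. m < j \<Longrightarrow> j < n \<Longrightarrow> f j = g j" "\<And>j. m < j \<Longrightarrow> j < n \<Longrightarrow> g j \<noteq> 0"
    and "(\<Prod>j = m + 1..n. f j) = (\<Prod>j = m + 1..n. g j)"
  shows "f n = g n"
proof -
  have split: "(\<Prod>j = m + 1..n. u j) = (\<Prod>j \<in> {m + 1..<n}. u j) * u n" for u :: "nat \<Rightarrow> real"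
  proof -
    have "{m + 1..n} = insert n {m + 1..<n}" using assms(1) by auto
    then show ?thesis by (simp add: mult.commute)
  qed
  have "(\<Prod>j \<in> {m + 1..<n}. f j) = (\<Prod>j \<in> {m + 1..<n}. g j)"
    by (intro prod.cong) (auto simp: assms(2))
  moreover have "(\<Prod>j \<in> {m + 1..<n}. g j) \<noteq> 0"
    by (simp add: assms(3))
  ultimately show ?thesis
    using assms(4) unfolding split by simp
qed

text \<open>Writing $n = 2^s(2k+1)$, the equation for $(s,k)$ has $n$ as its largest index: \<open>c n\<close> occurs
squared, with the nonzero product of earlier values as its coefficient, and all other terms are earlier
values.\<close>

lemma coeff_system_unique:
  assumes c: "coeff_system \<gamma> N c" and d: "coeff_system \<gamma> N d"
    and pos: "\<And>n. 1 \<le> n \<Longrightarrow> n \<le> N \<Longrightarrow> c n > 0" "\<And>n. 1 \<le> n \<Longrightarrow> n \<le> N \<Longrightarrow> d n > 0"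
    and "1 \<le> n" "n \<le> N"
  shows "c n = d n"
  using assms(5,6)
proof (induction n rule: less_induct)
  case (less n)
  obtain l where "n = 2 ^ multiplicity 2 n * l" "odd l"
    using less.prems(1) multiplicity_decompose'[of n 2] by auto
  then obtain s where l: "n = 2 ^ s * l" "odd l" by blast
  then obtain k where k: "l = 2 * k + 1" by (auto elim: oddE)
  have IH: "c j = d j" "d j \<noteq> 0" if "1 \<le> j" "j < n" for j
    using less that pos(2)[of j] by auto
  have "(c n)\<^sup>2 = (d n)\<^sup>2"
  proof (cases "k = 0")
    case True
    then have n: "n = 2 ^ s" using l k by simp
    have "(\<Prod>j = 1..n. e j)\<^sup>2 = (1 - 2 * \<gamma> (s+1)) * (rr \<gamma> s)\<^sup>2 / 4" if "coeff_system \<gamma> N e" for e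
      using that less.prems unfolding coeff_system_def n by blast
    from this[OF c] this[OF d]
    have "(\<Prod>j = 0 + 1..n. (c j)\<^sup>2) = (\<Prod>j = 0 + 1..n. (d j)\<^sup>2)"
      by (simp add: prod_power_distrib)
    then show ?thesis
      by (rule prod_top_cancel[rotated 3]) (use IH less.prems in auto)
  next
    case False
    have n: "n = 2 ^ s * (2 * k + 1)" using l k by simp
    have top: "2 ^ (s + 1) * k < n" by (simp add: n)
    have "(\<Prod>j = 2^(s+1)*k - 2^s + 1 .. 2^(s+1)*k. (c j)\<^sup>2) = (\<Prod>j = 2^(s+1)*k - 2^s + 1 .. 2^(s+1)*k. (d j)\<^sup>2)"
      using top IH by (intro prod.cong) auto
    moreover have "(\<Prod>j = 2^(s+1)*k + 1 .. n. (e j)\<^sup>2)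
        + (\<Prod>j = 2^(s+1)*k - 2^s + 1 .. 2^(s+1)*k. (e j)\<^sup>2) = (1 - 2 * \<gamma> (s+1)) * (rr \<gamma> s)\<^sup>2 / 4"
      if "coeff_system \<gamma> N e" for e
      using that False less.prems unfolding coeff_system_def n by simp
    from this[OF c] this[OF d] calculation
    have "(\<Prod>j = 2^(s+1)*k + 1 .. n. (c j)\<^sup>2) = (\<Prod>j = 2^(s+1)*k + 1 .. n. (d j)\<^sup>2)"
      by simp
    then show ?thesis
      by (rule prod_top_cancel[OF top, rotated 2]) (use IH in auto)
  qed
  then show ?case
    using pos less.prems by (metis less_imp_le power2_eq_imp_eq)
qed

theorem theorem4p3:
  fixes \<gamma> :: "nat \<Rightarrow> real" and \<mu> :: "real measure"
    and Q :: "nat \<Rightarrow> real poly" and a b :: "nat \<Rightarrow> real"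
  assumes gamma: "\<And>s. s \<ge> 1 \<Longrightarrow> 0 < \<gamma> s \<and> \<gamma> s < 1/4"
    and cap: "log_capacity (K_set \<gamma>) > 0"
    and equilibrium: "is_equilibrium_measure (K_set \<gamma>) \<mu>"
    and orth: "monic_orthogonal_polys \<mu> Q"
    and coeffs: "recurrence_coeffs Q a b"
  shows
    "(\<forall>s k. k \<ge> 1 \<longrightarrow>
        (\<Prod>j = 2^(s+1)*k + 1 .. 2^s*(2*k+1). (a j)\<^sup>2)
      + (\<Prod>j = 2^(s+1)*k - 2^s + 1 .. 2^(s+1)*k. (a j)\<^sup>2)
      = (L2_norm \<mu> (poly (Q (2^s))))\<^sup>2)
   \<and> (\<forall>s. (L2_norm \<mu> (poly (Q (2^s))))\<^sup>2 = (LINT x|\<mu>. (poly (Q (2^s)) x)\<^sup>2)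
        \<and> (LINT x|\<mu>. (poly (Q (2^s)) x)\<^sup>2) = (1 - 2 * \<gamma> (s+1)) * (rr \<gamma> s)\<^sup>2 / 4)
   \<and> (\<forall>N c. (\<forall>n\<in>{1..N}. c n > 0) \<longrightarrow>
        (coeff_system \<gamma> N c \<longleftrightarrow> (\<forall>n\<in>{1..N}. c n = a n)))"
proof -
  have "min_energy (K_set \<gamma>) \<noteq> \<infinity>"
    using cap by (auto simp: log_capacity_def)
  then interpret equilibrium_polys \<gamma> \<mu> Q a b
    using assms by unfold_locales auto
  have "coeff_system \<gamma> N c \<longleftrightarrow> (\<forall>n\<in>{1..N}. c n = a n)" if "\<forall>n\<in>{1..N}. c n > 0" for N c
  proof
    assume "coeff_system \<gamma> N c"
    then show "\<forall>n\<in>{1..N}. c n = a n"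
      using that a_pos by (intro ballI coeff_system_unique[OF _ coeff_system_a[of N]]) auto
  next
    assume "\<forall>n\<in>{1..N}. c n = a n"
    then show "coeff_system \<gamma> N c"
      using coeff_system_cong[of N c a \<gamma>] coeff_system_a[of N] by simp
  qed
  then show ?thesis
    unfolding L2_norm_squared integral_square
    by (intro conjI allI impI) (simp_all only: sum_identity h_power_of_2 square_shift_eq)
qed

end
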